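(* Let $n$ be an odd positive integer and let $k$ be a positive integer such that $k$ divides $n2^{n-1}$ and $k \leq n$. Then the $n$-dimensional hypercube $Q_n$ can be decomposed into paths of length $k$.
   Context: The $n$-dimensional hypercube $Q_n$ is the graph with vertex set $\{0,1\}^n$ in which two vertices $x,y$ are adjacent iff $\|x-y\|_1 = 1$. A path of length $k$ is a sequence of distinct vertices $x_1,\dots,x_{k+1}$ with $x_i x_{i+1}$ an edge for all $1\le i\le k$. A decomposition of a graph into paths of length $k$ is a collection of paths of length $k$ in the graph whose edge sets partition the edge set of the graph (every edge lies in exactly one of the paths). *)

theory Defs
  imports "HOL-Library.FuncSet"
begin

text \<open>
  A simple graph is given by its vertex set \<open>V\<close> and its edge set \<open>E\<close>, whose members are
  unordered pairs \<open>{x, y}\<close> of vertices.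
\<close>

definition hypercube_verts :: "nat \<Rightarrow> (nat \<Rightarrow> int) set" where
  "hypercube_verts n = {..<n} \<rightarrow>\<^sub>E {0, 1}"

definition l1_dist :: "nat \<Rightarrow> (nat \<Rightarrow> int) \<Rightarrow> (nat \<Rightarrow> int) \<Rightarrow> int" where
  "l1_dist n x y = (\<Sum>i<n. \<bar>x i - y i\<bar>)"

definition hypercube_edges :: "nat \<Rightarrow> (nat \<Rightarrow> int) set set" where
  "hypercube_edges n =
     {{x, y} | x y. x \<in> hypercube_verts n \<and> y \<in> hypercube_verts n \<and> l1_dist n x y = 1}"

text \<open>The length of a path counts edges, so a path of length \<open>k\<close> lists \<open>k + 1\<close> vertices.\<close>

definition is_path_of_length :: "'a set \<Rightarrow> 'a set set \<Rightarrow> nat \<Rightarrow> 'a list \<Rightarrow> bool" where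
  "is_path_of_length V E k p \<longleftrightarrow>
     length p = k + 1 \<and> set p \<subseteq> V \<and> distinct p \<and> (\<forall>i<k. {p ! i, p ! (i + 1)} \<in> E)"

definition path_edges :: "'a list \<Rightarrow> 'a set set" where
  "path_edges p = {{p ! i, p ! (i + 1)} | i. i + 1 < length p}"

text \<open>
  A path and its reversal are different vertex sequences with the same edges. For \<open>k > 0\<close> the
  uniqueness below prevents a decomposition from containing both.
\<close>

definition is_path_decomposition :: "'a set \<Rightarrow> 'a set set \<Rightarrow> nat \<Rightarrow> 'a list set \<Rightarrow> bool" where
  "is_path_decomposition V E k P \<longleftrightarrow>
     (\<forall>p\<in>P. is_path_of_length V E k p) \<and> (\<forall>e\<in>E. \<exists>!p. p \<in> P \<and> e \<in> path_edges p)"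

end

theory Submission
  imports Defs "HOL-Library.Disjoint_Sets"
begin

text \<open>
  Write \<open>k = m 2\<^sup>s\<close> with \<open>m\<close> odd; then \<open>m\<close> divides \<open>n\<close>, say \<open>n = m q\<close>, and \<open>2\<^sup>s \<le> q\<close>. For odd \<open>m\<close> the
  \<open>m\<close>-cube decomposes into paths of length \<open>m\<close> between antipodal vertices, so the \<open>n\<close>-cube decomposes
  into copies of the \<open>q\<close>-cube with every edge subdivided into \<open>m\<close> edges. Hence only paths of length
  \<open>N = 2\<^sup>s\<close> in the \<open>q\<close>-cube have to be found, and \<open>N < q\<close> unless \<open>N = 1\<close>.

  Two directions span 4-cycles. Orient all of them: this gives permutations of the vertices, one for
  each pair of directions, that together traverse every edge once. Combining permutations of two
  disjoint sets of directions in the manner of Hamiltonian cycles on a torus squares the length of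
  the orbits, so \<open>2v\<close> directions (\<open>v\<close> a power of two) decompose into \<open>v\<close> permutations all of whose
  orbits have length divisible by \<open>2N\<close>. Each of these permutations decomposes into paths of length
  \<open>N\<close>; in particular \<open>2v\<close> directions can be split off, and \<open>q = N + \<rho>\<close> with \<open>\<rho> < 2v\<close> odd remains.

  Let \<open>q = 2t + 1\<close> and view the \<open>q\<close>-cube as two layers joined by a perfect matching. In the two
  layers reserve \<open>u\<close> and \<open>\<rho> - u\<close> of the long permutations. Applying the remaining \<open>t - u\<close>
  permutations one after the other gives a path from every vertex of the first layer, likewise with
  \<open>t - (\<rho> - u)\<close> in the second layer. Joining both along the matching edges gives paths of length
  \<open>2t - \<rho> + 1 = N\<close>, and the reserved permutations decompose into paths of length \<open>N\<close> as well.
\<close>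

section \<open>Path decompositions\<close>

text \<open>The vertex set is \<open>UNIV\<close>, so that only edge sets have to be tracked;
  \<open>decomposable_restrict\<close> returns to a chosen vertex set when one is wanted.\<close>

definition decomposable :: "'a set set \<Rightarrow> nat \<Rightarrow> bool" where
  "decomposable X k \<longleftrightarrow> (\<exists>P. is_path_decomposition UNIV X k P)"

lemma path_edges_subset:
  assumes "is_path_of_length V X k p"
  shows "path_edges p \<subseteq> X"
  using assms by (auto simp: is_path_of_length_def path_edges_def)

text \<open>Injectivity jointly in walk and time says that no edge is traversed twice, neither by
  one walk nor by two of them; this makes the path through an edge unique.\<close>

lemma decomposable_walks:
  assumes inj: "\<And>s. s \<in> S \<Longrightarrow> inj_on (w s) {..k}"
    and edges: "inj_on (\<lambda>(s, j). {w s j, w s (Suc j)}) (S \<times> {..<k})"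
  shows "decomposable ((\<lambda>(s, j). {w s j, w s (Suc j)}) ` (S \<times> {..<k})) k"
proof -
  define pth where "pth s = map (w s) [0..<Suc k]" for s
  let ?X = "(\<lambda>(s, j). {w s j, w s (Suc j)}) ` (S \<times> {..<k})"
  have nth: "pth s ! j = w s j" if "j \<le> k" for s j
    using that unfolding pth_def by (subst nth_map) (auto simp del: upt_Suc)
  have len: "length (pth s) = Suc k" for s by (simp add: pth_def)
  have pe: "path_edges (pth s) = {{w s j, w s (Suc j)} | j. j < k}" for s
    unfolding path_edges_def len by (rule Collect_cong) (metis Suc_eq_plus1 Suc_leI Suc_less_eq less_or_eq_imp_le nth)
  have "is_path_of_length UNIV ?X k (pth s)" if "s \<in> S" for s
  proof -
    have "distinct (pth s)"
      using inj[OF that] unfolding pth_def distinct_map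
      by (auto simp del: upt_Suc intro: inj_on_subset)
    then show ?thesis
      using that nth[of _ s] by (auto simp: is_path_of_length_def len)
  qed
  moreover have "\<exists>!p. p \<in> pth ` S \<and> e \<in> path_edges p" if "e \<in> ?X" for e
  proof -
    from that obtain s j where sj: "s \<in> S" "j < k" "e = {w s j, w s (Suc j)}" by auto
    show ?thesis
    proof (rule ex1I[of _ "pth s"])
      show "pth s \<in> pth ` S \<and> e \<in> path_edges (pth s)" using sj by (auto simp: pe)
      fix p assume "p \<in> pth ` S \<and> e \<in> path_edges p"
      then obtain s' j' where "p = pth s'" "s' \<in> S" "j' < k" "e = {w s' j', w s' (Suc j')}"
        by (auto simp: pe)
      then show "p = pth s" using inj_onD[OF edges, of "(s, j)" "(s', j')"] sj by auto
    qed
  qed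
  ultimately show ?thesis unfolding decomposable_def is_path_decomposition_def
    by (intro exI[of _ "pth ` S"]) auto
qed

lemma decomposable_UN:
  assumes dec: "\<And>i. i \<in> A \<Longrightarrow> decomposable (X i) k"
    and disj: "disjoint_family_on X A"
  shows "decomposable (\<Union>i\<in>A. X i) k"
proof -
  obtain P where P: "\<And>i. i \<in> A \<Longrightarrow> is_path_decomposition UNIV (X i) k (P i)"
    using dec unfolding decomposable_def by metis
  have sub: "path_edges p \<subseteq> X i" if "i \<in> A" "p \<in> P i" for i p
    using P[OF that(1)] that(2) path_edges_subset unfolding is_path_decomposition_def by metis
  have "is_path_of_length UNIV (\<Union>i\<in>A. X i) k p" if "i \<in> A" "p \<in> P i" for i p
  proof -
    have "is_path_of_length UNIV (X i) k p"
      using P that unfolding is_path_decomposition_def by blast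
    then show ?thesis unfolding is_path_of_length_def using that by auto
  qed
  moreover have "\<exists>!p. p \<in> (\<Union>i\<in>A. P i) \<and> e \<in> path_edges p" if e: "e \<in> (\<Union>i\<in>A. X i)" for e
  proof -
    obtain i where i: "i \<in> A" "e \<in> X i" using e by auto
    obtain p where p: "p \<in> P i" "e \<in> path_edges p"
      and uniq: "\<And>q. q \<in> P i \<Longrightarrow> e \<in> path_edges q \<Longrightarrow> q = p"
      using P[OF i(1)] i(2) unfolding is_path_decomposition_def by metis
    show ?thesis
    proof (rule ex1I[of _ p])
      fix q assume "q \<in> (\<Union>i\<in>A. P i) \<and> e \<in> path_edges q"
      then obtain j where j: "j \<in> A" "q \<in> P j" "e \<in> path_edges q" by auto
      then have "e \<in> X j" using sub by blast
      then have "j = i" using disj i j unfolding disjoint_family_on_def by blast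
      then show "q = p" using uniq j by simp
    qed (use i p in auto)
  qed
  ultimately show ?thesis unfolding decomposable_def is_path_decomposition_def
    by (intro exI[of _ "\<Union>i\<in>A. P i"]) auto
qed

lemma decomposable_Un:
  assumes "decomposable X k" "decomposable Y k" "X \<inter> Y = {}"
  shows "decomposable (X \<union> Y) k"
proof -
  have "decomposable (\<Union>b\<in>UNIV. if b then X else Y) k"
    using assms by (intro decomposable_UN) (auto simp: disjoint_family_on_def)
  moreover have "(\<Union>b\<in>UNIV. if b then X else Y) = X \<union> Y" by (auto split: if_splits)
  ultimately show ?thesis by simp
qed

text \<open>No edge of \<open>X\<close> leaves \<open>S\<close>, so a path with one edge inside
  \<open>S\<close> stays in \<open>S\<close>. The paths inside \<open>S\<close> therefore cover
  exactly the edges inside \<open>S\<close>.\<close>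

lemma decomposable_restrict:
  assumes dec: "decomposable X k"
    and closed: "\<And>a b. {a, b} \<in> X \<Longrightarrow> a \<in> S \<Longrightarrow> b \<in> S"
  shows "\<exists>P. is_path_decomposition S {e \<in> X. e \<subseteq> S} k P"
proof -
  obtain P where P: "is_path_decomposition UNIV X k P" using dec unfolding decomposable_def by auto
  have closed': "{a, b} \<in> X \<Longrightarrow> b \<in> S \<Longrightarrow> a \<in> S" for a b
    using closed[of b a] by (simp add: insert_commute)
  have path: "is_path_of_length UNIV X k p" if "p \<in> P" for p
    using P that unfolding is_path_decomposition_def by blast
  have inside: "set p \<subseteq> S" if p: "p \<in> P" and e: "e \<in> path_edges p" "e \<subseteq> S" for p e
  proof -
    have len: "length p = k + 1" and E: "\<And>i. i < k \<Longrightarrow> {p ! i, p ! Suc i} \<in> X"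
      using path[OF p] by (auto simp: is_path_of_length_def)
    obtain i where i: "i < k" "p ! i \<in> S"
      using e len by (auto simp: path_edges_def)
    have fwd: "j \<le> k \<Longrightarrow> (p ! j \<in> S \<longleftrightarrow> p ! 0 \<in> S)" for j
    proof (induction j)
      case (Suc j)
      then have "{p ! j, p ! Suc j} \<in> X" using E by simp
      then show ?case using Suc closed closed' by (meson Suc_leD)
    qed simp
    have "p ! 0 \<in> S" using fwd[of i] i by auto
    then have "p ! j \<in> S" if "j < length p" for j
      using fwd[of j] that len by simp
    then show ?thesis by (metis in_set_conv_nth subsetI)
  qed
  have "is_path_of_length S {e \<in> X. e \<subseteq> S} k p" if "p \<in> P" "set p \<subseteq> S" for p
    using path[OF that(1)] that(2) unfolding is_path_of_length_def by auto
  moreover have "\<exists>!p. p \<in> {p \<in> P. set p \<subseteq> S} \<and> e \<in> path_edges p" if "e \<in> {e \<in> X. e \<subseteq> S}" for e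
  proof -
    have "\<exists>!p. p \<in> P \<and> e \<in> path_edges p"
      using P that unfolding is_path_decomposition_def by blast
    then obtain p where p: "p \<in> P" "e \<in> path_edges p"
      and uniq: "\<And>q. q \<in> P \<Longrightarrow> e \<in> path_edges q \<Longrightarrow> q = p" by metis
    then have "set p \<subseteq> S" using inside that by blast
    then show ?thesis using p uniq by blast
  qed
  ultimately show ?thesis unfolding is_path_decomposition_def
    by (intro exI[of _ "{p \<in> P. set p \<subseteq> S}"]) auto
qed

lemma is_path_decomposition_UNIV:
  assumes "is_path_decomposition S X k P"
  shows "decomposable X k"
  using assms unfolding decomposable_def is_path_decomposition_def is_path_of_length_def
  by (intro exI[of _ P]) simp

section \<open>Transport of decompositions along injective maps\<close>

lemma path_edges_map: "path_edges (map h p) = (`) h ` path_edges p"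
proof -
  have "{map h p ! i, map h p ! (i + 1)} = h ` {p ! i, p ! (i + 1)}" if "i + 1 < length p" for i
    using that by simp
  then have "path_edges (map h p) = {h ` {p ! i, p ! (i + 1)} | i. i + 1 < length p}"
    unfolding path_edges_def length_map by (intro Collect_cong) metis
  also have "\<dots> = (`) h ` path_edges p"
    unfolding path_edges_def by blast
  finally show ?thesis .
qed

lemma is_path_decomposition_image:
  assumes dec: "is_path_decomposition S X k P"
    and inj: "inj_on h S" and sub: "\<Union>X \<subseteq> S"
  shows "is_path_decomposition (h ` S) ((`) h ` X) k (map h ` P)"
proof -
  have path: "is_path_of_length S X k p" if "p \<in> P" for p
    using dec that unfolding is_path_decomposition_def by blast
  have "is_path_of_length (h ` S) ((`) h ` X) k (map h p)" if "p \<in> P" for p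
  proof -
    have "distinct (map h p)"
      using path[OF that] inj_on_subset[OF inj] unfolding is_path_of_length_def distinct_map by blast
    moreover have "{map h p ! i, map h p ! (i + 1)} \<in> (`) h ` X" if "i < k" for i
    proof -
      have "{p ! i, p ! (i + 1)} \<in> X" "length p = k + 1"
        using path[OF \<open>p \<in> P\<close>] that unfolding is_path_of_length_def by auto
      then show ?thesis using that by (auto intro!: image_eqI[of _ _ "{p ! i, p ! (i + 1)}"])
    qed
    ultimately show ?thesis
      using path[OF that] unfolding is_path_of_length_def by auto
  qed
  moreover have "\<exists>!p. p \<in> map h ` P \<and> e \<in> path_edges p" if "e \<in> (`) h ` X" for e
  proof -
    from that obtain e0 where e0: "e0 \<in> X" "e = h ` e0" by (rule imageE)
    obtain p where p: "p \<in> P" "e0 \<in> path_edges p"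
      and uniq: "\<And>q. q \<in> P \<Longrightarrow> e0 \<in> path_edges q \<Longrightarrow> q = p"
      using dec e0 unfolding is_path_decomposition_def by metis
    show ?thesis
    proof (rule ex1I[of _ "map h p"])
      fix q assume "q \<in> map h ` P \<and> e \<in> path_edges q"
      then obtain q' e1 where q': "q = map h q'" "q' \<in> P" "e1 \<in> path_edges q'" "e = h ` e1"
        by (auto simp: path_edges_map)
      have "e1 \<in> X" using path_edges_subset[OF path] q' by blast
      then have "e1 = e0" using inj_on_image_eq_iff[OF inj] e0 q'(4) sub by (metis Sup_upper subset_trans)
      then show "q = map h p" using uniq q' by simp
    qed (use p e0 in \<open>auto simp: path_edges_map\<close>)
  qed
  ultimately show ?thesis unfolding is_path_decomposition_def by auto
qed

section \<open>Orientations of the cube\<close>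

text \<open>A 0-1 vector is encoded as the set of its coordinates with value one; flipping a
  coordinate is the symmetric difference with a singleton.\<close>

definition flip :: "nat \<Rightarrow> nat set \<Rightarrow> nat set" where
  "flip d x = {b. (b \<in> x) \<noteq> (b = d)}"

lemma mem_flip [simp]: "b \<in> flip d x \<longleftrightarrow> (b \<in> x) \<noteq> (b = d)"
  by (simp add: flip_def)

lemma flip_flip [simp]: "flip d (flip d x) = x"
  by auto

lemma flip_dir_inject [simp]: "flip d x = flip e x \<longleftrightarrow> d = e"
  by (metis mem_flip)

lemma flip_neq [simp]: "flip d x \<noteq> x" "x \<noteq> flip d x"
  by (metis mem_flip)+

lemma flip_Int: "d \<notin> D \<Longrightarrow> flip d x \<inter> D = x \<inter> D"
  by (auto simp: flip_def)

lemma flip_Int_neq: "d \<in> D \<Longrightarrow> flip d x \<inter> D \<noteq> x \<inter> D"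
  by (metis IntD1 IntI mem_flip)

lemma flip_edge_eq_iff:
  "{x, flip d x} = {y, flip e y} \<longleftrightarrow> d = e \<and> (x = y \<or> x = flip d y)"
proof -
  have "flip d x = y \<longleftrightarrow> x = flip d y" for x y d by auto
  then have "x = flip e y \<and> flip d x = y \<longleftrightarrow> x = flip e y \<and> d = e" by (metis flip_dir_inject)
  then show ?thesis unfolding doubleton_eq_iff by (metis flip_dir_inject)
qed

text \<open>
  All sets of naturals are vertices, so \<open>cube_edges I\<close> is a disjoint union of infinitely many copies
  of the cube with directions \<open>I\<close>; disjoint sets of directions can then be handled independently.
\<close>

definition cube_edges :: "nat set \<Rightarrow> nat set set set" where
  "cube_edges I = {{x, flip d x} | x d. d \<in> I}"

lemma cube_edges_Un: "cube_edges (I \<union> J) = cube_edges I \<union> cube_edges J"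
  unfolding cube_edges_def by blast

lemma cube_edges_disjoint: "I \<inter> J = {} \<Longrightarrow> cube_edges I \<inter> cube_edges J = {}"
  unfolding cube_edges_def by (auto simp: flip_edge_eq_iff)

lemma flip_edge_in_cube_edges [simp]: "{x, flip d x} \<in> cube_edges I \<longleftrightarrow> d \<in> I"
  unfolding cube_edges_def by (auto simp: flip_edge_eq_iff)

lemma cube_edgeD: "{x, y} \<in> cube_edges I \<Longrightarrow> \<exists>d\<in>I. y = flip d x"
  unfolding cube_edges_def by (auto simp: doubleton_eq_iff)

text \<open>Each edge receives one direction and one of \<open>v\<close> colours such that at every
  vertex each colour has one outgoing and one incoming edge; consequently \<open>I\<close> has
  \<open>2 * v\<close> elements.\<close>

definition orients :: "nat set \<Rightarrow> nat \<Rightarrow> (nat \<Rightarrow> nat set \<Rightarrow> nat set) \<Rightarrow> bool" where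
  "orients I v f \<longleftrightarrow> (\<forall>i<v. bij (f i)) \<and>
     bij_betw (\<lambda>(i, x). {x, f i x}) ({..<v} \<times> UNIV) (cube_edges I)"

lemma orients_bij: "orients I v f \<Longrightarrow> i < v \<Longrightarrow> bij (f i)"
  by (simp add: orients_def)

lemma orients_flip:
  assumes "orients I v f" "i < v"
  shows "\<exists>d\<in>I. f i x = flip d x"
proof (rule cube_edgeD)
  show "{x, f i x} \<in> cube_edges I"
    using assms unfolding orients_def bij_betw_def by blast
qed

lemma orients_inj:
  assumes "orients I v f" "i < v" "j < v" "{x, f i x} = {y, f j y}"
  shows "i = j \<and> x = y"
proof -
  have "inj_on (\<lambda>(i, x). {x, f i x}) ({..<v} \<times> UNIV)"
    using assms(1) by (simp add: orients_def bij_betw_def)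
  from inj_onD[OF this, of "(i, x)" "(j, y)"] show ?thesis using assms by simp
qed

lemma orients_surj:
  assumes "orients I v f" "d \<in> I"
  shows "\<exists>i<v. \<exists>y. {x, flip d x} = {y, f i y}"
proof -
  have "{x, flip d x} \<in> (\<lambda>(i, x). {x, f i x}) ` ({..<v} \<times> UNIV)"
    using assms unfolding orients_def bij_betw_def by simp
  then show ?thesis by auto
qed

lemma orientsI:
  assumes "\<And>i. i < v \<Longrightarrow> bij (f i)"
    and "\<And>i x. i < v \<Longrightarrow> \<exists>d\<in>I. f i x = flip d x"
    and inj: "\<And>i j x y. i < v \<Longrightarrow> j < v \<Longrightarrow> {x, f i x} = {y, f j y} \<Longrightarrow> i = j \<and> x = y"
    and surj: "\<And>d x. d \<in> I \<Longrightarrow> \<exists>i<v. \<exists>y. {x, flip d x} = {y, f i y}"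
  shows "orients I v f"
proof -
  have "inj_on (\<lambda>(i, x). {x, f i x}) ({..<v} \<times> UNIV)"
    using inj by (intro inj_onI) auto
  moreover have "(\<lambda>(i, x). {x, f i x}) ` ({..<v} \<times> UNIV) = cube_edges I" (is "?L = _")
  proof
    show "?L \<subseteq> cube_edges I"
    proof
      fix e assume "e \<in> ?L"
      then obtain i x where "i < v" "e = {x, f i x}" by auto
      moreover from this obtain d where "d \<in> I" "f i x = flip d x" using assms(2) by blast
      ultimately show "e \<in> cube_edges I" by simp
    qed
    show "cube_edges I \<subseteq> ?L"
    proof
      fix e assume "e \<in> cube_edges I"
      then obtain x d where "e = {x, flip d x}" "d \<in> I" unfolding cube_edges_def by auto
      then obtain i y where "i < v" "e = {y, f i y}" using surj by metis
      then show "e \<in> ?L" by auto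
    qed
  qed
  ultimately show ?thesis using assms(1) by (simp add: orients_def bij_betw_def)
qed

lemma orients_cong:
  assumes "orients I v f" "\<And>i. i < v \<Longrightarrow> g i = f i"
  shows "orients I v g"
proof (rule orientsI)
  show "bij (g i)" "\<exists>d\<in>I. g i x = flip d x" if "i < v" for i x
    using orients_bij[OF assms(1) that] orients_flip[OF assms(1) that] assms(2)[OF that] by simp_all
  show "i = j \<and> x = y" if "i < v" "j < v" "{x, g i x} = {y, g j y}" for i j x y
    using orients_inj[OF assms(1), of i j x y] assms(2) that by simp
  show "\<exists>i<v. \<exists>y. {x, flip d x} = {y, g i y}" if "d \<in> I" for d x
    using orients_surj[OF assms(1) that, of x] assms(2) by metis
qed

lemma orients_Un:
  assumes f: "orients I v f" and g: "orients J w g" and disj: "I \<inter> J = {}"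
  shows "orients (I \<union> J) (v + w) (\<lambda>i. if i < v then f i else g (i - v))" (is "orients _ _ ?h")
proof (rule orientsI)
  have in_I: "{x, ?h i x} \<in> cube_edges I" if "i < v" for i x
    using orients_flip[OF f that, of x] that by auto
  have in_J: "{x, ?h i x} \<in> cube_edges J" if "\<not> i < v" "i < v + w" for i x
  proof -
    have "i - v < w" using that by simp
    then show ?thesis using orients_flip[OF g, of "i - v" x] that by auto
  qed
  fix i assume i: "i < v + w"
  have iw: "i - v < w" if "\<not> i < v" using i that by simp
  show "bij (?h i)" using iw orients_bij[OF f] orients_bij[OF g, of "i - v"] by auto
  show "\<exists>d\<in>I \<union> J. ?h i x = flip d x" for x
    using iw orients_flip[OF f, of i x] orients_flip[OF g, of "i - v" x] by auto
  fix j x y assume j: "j < v + w" and eq: "{x, ?h i x} = {y, ?h j y}"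
  have "i < v \<longleftrightarrow> j < v"
    using in_I[of i x] in_I[of j y] in_J[of i x] in_J[of j y] i j eq cube_edges_disjoint[OF disj]
    by (metis disjoint_iff)
  then show "i = j \<and> x = y"
  proof (cases "i < v")
    case True
    then show ?thesis using \<open>i < v \<longleftrightarrow> j < v\<close> orients_inj[OF f, of i j x y] eq by simp
  next
    case False
    then have "\<not> j < v" "i - v < w" "j - v < w" using \<open>i < v \<longleftrightarrow> j < v\<close> i j by auto
    then show ?thesis using False orients_inj[OF g, of "i - v" "j - v" x y] eq by auto
  qed
next
  fix d x assume "d \<in> I \<union> J"
  then show "\<exists>i<v + w. \<exists>y. {x, flip d x} = {y, ?h i y}"
  proof
    assume "d \<in> I"
    then obtain i y where "i < v" "{x, flip d x} = {y, f i y}" using orients_surj[OF f] by metis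
    then show ?thesis by (intro exI[of _ i]) auto
  next
    assume "d \<in> J"
    then obtain i y where "i < w" "{x, flip d x} = {y, g i y}" using orients_surj[OF g] by metis
    then show ?thesis by (intro exI[of _ "v + i"]) auto
  qed
qed

text \<open>
  A clock modulo \<open>L\<close> forces every orbit of \<open>f\<close> to have length divisible by \<open>L\<close>, and it marks the
  points at which the orbits can be cut consistently.
\<close>

definition clocked :: "nat set \<Rightarrow> nat \<Rightarrow> (nat set \<Rightarrow> nat set) \<Rightarrow> (nat set \<Rightarrow> nat) \<Rightarrow> bool" where
  "clocked I L f c \<longleftrightarrow> (\<forall>x. c x < L \<and> c (f x) = Suc (c x) mod L) \<and>
     (\<forall>x. \<forall>d. d \<notin> I \<longrightarrow> c (flip d x) = c x)"

text \<open>In the coordinates \<open>d\<close>, \<open>Suc d\<close> this runs through the 4-cycle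
  00, 10, 11, 01.\<close>

definition rot :: "nat \<Rightarrow> nat set \<Rightarrow> nat set" where
  "rot d x = flip (if (d \<in> x) = (Suc d \<in> x) then d else Suc d) x"

lemma rot_flips: "rot d x = flip d x \<or> rot d x = flip (Suc d) x"
  by (simp add: rot_def)

lemma bij_rot: "bij (rot d)"
proof (rule o_bij)
  let ?g = "\<lambda>x. flip (if (d \<in> x) = (Suc d \<in> x) then Suc d else d) x"
  show "?g \<circ> rot d = id" by (auto simp: rot_def fun_eq_iff)
  show "rot d \<circ> ?g = id" by (auto simp: rot_def fun_eq_iff)
qed

lemma orients_rot: "orients {d, Suc d} 1 (\<lambda>_. rot d)"
proof (rule orientsI)
  show "bij (rot d)" by (rule bij_rot)
  show "\<exists>e\<in>{d, Suc d}. rot d x = flip e x" for x by (auto simp: rot_def)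
  show "j = k \<and> x = y" if "j < 1" "k < 1" "{x, rot d x} = {y, rot d y}" for j k :: nat and x y
    using that by (auto simp: rot_def flip_edge_eq_iff split: if_splits)
  fix e x assume e: "e \<in> {d, Suc d}"
  have "flip e x = rot d x \<or> x = rot d (flip e x)" using e by (auto simp: rot_def)
  then have "\<exists>y. {x, flip e x} = {y, rot d y}" by (metis insert_commute)
  then show "\<exists>j<1::nat. \<exists>y. {x, flip e x} = {y, rot d y}" by auto
qed

lemma clocked_rot: "\<exists>c. clocked {d, Suc d} 4 (rot d) c"
proof
  show "clocked {d, Suc d} 4 (rot d)
    (\<lambda>x. if d \<in> x then (if Suc d \<in> x then 2 else 1) else (if Suc d \<in> x then 3 else 0))"
    by (auto simp: clocked_def rot_def)
qed

section \<open>Permutations with long orbits\<close>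

text \<open>
  On a product of two cycles of length \<open>L\<close> with positions \<open>c, d\<close>, take the first coordinate's step
  unless \<open>c + d\<close> is divisible by \<open>L\<close>. Since \<open>c + d\<close> grows by one in every step, \<open>d\<close> grows by one per
  round of \<open>L\<close> steps, which makes \<open>L d + (c + d - 1) mod L\<close> a clock modulo \<open>L\<^sup>2\<close>.
\<close>

lemma clocked_double:
  assumes f: "clocked I L f c" "\<And>x. \<exists>d\<in>I. f x = flip d x"
    and g: "clocked J L g d" "\<And>x. \<exists>e\<in>J. g x = flip e x"
    and disj: "I \<inter> J = {}" and L: "L > 1"
  shows "clocked (I \<union> J) (L * L) (\<lambda>x. if (c x + d x) mod L = 0 then g x else f x)
    (\<lambda>x. L * d x + (c x + d x + (L - 1)) mod L)"
proof -
  have cf: "c (f x) = Suc (c x) mod L" "c x < L" and dg: "d (g x) = Suc (d x) mod L" "d x < L" for x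
    using f(1) g(1) by (auto simp: clocked_def)
  \<comment> \<open>A step of \<open>g\<close> flips a direction outside \<open>I\<close>, which the
    clock \<open>c\<close> does not see; symmetrically for \<open>f\<close> and \<open>d\<close>
    below.\<close>
  have cg: "c (g x) = c x" for x
    using f(1) g(2)[of x] disj unfolding clocked_def by (metis disjoint_iff)
  have df: "d (f x) = d x" for x
    using g(1) f(2)[of x] disj unfolding clocked_def by (metis disjoint_iff)
  have lt: "L * d x + r mod L < L * L" for x r
  proof -
    have "L * d x + r mod L < L * d x + L" using L by simp
    also have "\<dots> = L * Suc (d x)" by simp
    also have "\<dots> \<le> L * L" using dg(2)[of x] by (intro mult_le_mono2) simp
    finally show ?thesis .
  qed
  have step: "L * d y + (c y + d y + (L - 1)) mod L = Suc (L * d x + (c x + d x + (L - 1)) mod L) mod (L * L)"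
    if y: "y = (if (c x + d x) mod L = 0 then g x else f x)" for x y
  proof (cases "(c x + d x) mod L = 0")
    \<comment> \<open>The step of \<open>g\<close> closes a round: the remainder drops from
      \<open>L - 1\<close> to \<open>0\<close> while \<open>d\<close> advances, wrapping around
      modulo \<open>L\<close>.\<close>
    case True
    have "(c x + d x + (L - 1)) mod L = L - 1"
      using True L by (metis add_0 mod_add_left_eq mod_less diff_less zero_less_one less_trans)
    then have "Suc (L * d x + (c x + d x + (L - 1)) mod L) mod (L * L) = (L * Suc (d x)) mod (L * L)"
      using L by (simp add: add.commute)
    also have "\<dots> = L * (Suc (d x) mod L)" by (simp only: mult_mod_right)
    finally have 1: "Suc (L * d x + (c x + d x + (L - 1)) mod L) mod (L * L) = L * (Suc (d x) mod L)" .
    have "(c x + Suc (d x) mod L + (L - 1)) mod L = (c x + Suc (d x) + (L - 1)) mod L"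
      by (metis mod_add_left_eq mod_add_right_eq)
    also have "c x + Suc (d x) + (L - 1) = c x + d x + L" using L by simp
    also have "\<dots> mod L = (c x + d x) mod L" by simp
    also have "\<dots> = 0" using True by simp
    finally show ?thesis using True y 1 by (simp add: cg dg)
  next
    case False
    \<comment> \<open>Within a round \<open>d\<close> is fixed and the step of \<open>f\<close>
      raises the remainder from \<open>s - 1\<close> to \<open>s\<close>, without a carry.\<close>
    define s where "s = (c x + d x) mod L"
    have s: "0 < s" "s < L" using False L by (auto simp: s_def)
    have "(c x + d x + (L - 1)) mod L = (s + (L - 1)) mod L" by (simp add: s_def mod_add_left_eq)
    also have "s + (L - 1) = (s - 1) + L" using s by simp
    also have "(s - 1 + L) mod L = s - 1" using s by (subst mod_add_self2) simp
    finally have 1: "(c x + d x + (L - 1)) mod L = s - 1" .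
    have "(Suc (c x) mod L + d x + (L - 1)) mod L = (Suc (c x) + (d x + (L - 1))) mod L"
      by (metis add.assoc mod_add_left_eq)
    also have "Suc (c x) + (d x + (L - 1)) = (c x + d x) + L" using L by simp
    finally have 2: "(Suc (c x) mod L + d x + (L - 1)) mod L = s" by (simp add: s_def)
    have "Suc (L * d x + (s - 1)) = L * d x + s" using s by simp
    moreover have "\<dots> < L * L" using lt[of x s] s by simp
    ultimately show ?thesis using False y 1 2 by (simp add: cf df)
  qed
  have "c (flip e x) = c x \<and> d (flip e x) = d x" if "e \<notin> I \<union> J" for e x
    using that f(1) g(1) unfolding clocked_def by simp
  then show ?thesis using step lt unfolding clocked_def by simp
qed

text \<open>Both maps raise \<open>s\<close> by one modulo \<open>L\<close>, so the residue of
  \<open>s\<close> at an image reveals the residue at the preimage, and with it the map that was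
  applied. Residue \<open>1\<close> marks the images under \<open>g\<close>.\<close>

lemma bij_switch:
  assumes f: "bij f" and g: "bij g" and L: "L > 1"
    and sf: "\<And>x. s (f x) mod L = Suc (s x) mod L" and sg: "\<And>x. s (g x) mod L = Suc (s x) mod L"
  shows "bij (\<lambda>x. if (s x :: nat) mod L = 0 then g x else f x)" (is "bij ?h")
proof (rule bijI)
  have sh: "s (?h x) mod L = Suc (s x) mod L" for x using sf sg by simp
  have Suc_eq: "a mod L = b mod L" if "Suc a mod L = Suc b mod L" for a b
    using that by (simp add: mod_Suc split: if_splits)
  show "inj ?h"
  proof (rule injI)
    fix x y assume eq: "?h x = ?h y"
    have "Suc (s x) mod L = Suc (s y) mod L" using sh[of x] sh[of y] unfolding eq by simp
    then have "s x mod L = s y mod L" by (rule Suc_eq)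
    then show "x = y"
      using eq injD[OF bij_is_inj[OF f], of x y] injD[OF bij_is_inj[OF g], of x y]
      by (cases "s x mod L = 0") simp_all
  qed
  show "surj ?h"
  proof (rule surjI)
    fix y
    let ?x = "if s y mod L = 1 then inv g y else inv f y"
    have gf: "g (inv g y) = y" "f (inv f y) = y"
      using f g by (simp_all add: bij_is_surj surj_f_inv_f)
    have iff: "Suc a mod L = 1 \<longleftrightarrow> a mod L = 0" for a using L by (auto simp: mod_Suc)
    have "s y mod L = 1 \<longleftrightarrow> s (inv g y) mod L = 0" "s y mod L = 1 \<longleftrightarrow> s (inv f y) mod L = 0"
      using sg[of "inv g y"] sf[of "inv f y"] iff[of "s (inv g y)"] iff[of "s (inv f y)"]
      unfolding gf by simp_all
    then show "?h ?x = y" using gf by (cases "s y mod L = 1") simp_all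
  qed
qed

text \<open>Each pair \<open>f i\<close>, \<open>g i\<close> gives two switched maps, index
  \<open>i\<close> using \<open>g i\<close> where \<open>c i + d i\<close> is divisible by
  \<open>L\<close> and \<open>f i\<close> elsewhere, index \<open>v + i\<close> the other way round.
  Between them they use every step of \<open>f i\<close> and of \<open>g i\<close> exactly
  once.\<close>

lemma clocked_orients_double:
  assumes f: "orients I v f" "\<And>i. i < v \<Longrightarrow> clocked I L (f i) (c i)"
    and g: "orients J v g" "\<And>i. i < v \<Longrightarrow> clocked J L (g i) (d i)"
    and disj: "I \<inter> J = {}" and L: "L > 1"
  shows "\<exists>h e. orients (I \<union> J) (2 * v) h \<and> (\<forall>i<2 * v. clocked (I \<union> J) (L * L) (h i) (e i))"
proof (intro exI conjI allI impI)
  define s where "s i x = c i x + d i x" for i x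
  define h where "h i = (if i < v then (\<lambda>x. if s i x mod L = 0 then g i x else f i x)
    else (\<lambda>x. if s (i - v) x mod L = 0 then f (i - v) x else g (i - v) x))" for i
  define e where "e i = (if i < v then (\<lambda>x. L * d i x + (c i x + d i x + (L - 1)) mod L)
    else (\<lambda>x. L * c (i - v) x + (d (i - v) x + c (i - v) x + (L - 1)) mod L))" for i
  have f': "\<exists>d\<in>I. f i x = flip d x" and g': "\<exists>d\<in>J. g i x = flip d x" if "i < v" for i x
    using orients_flip f g that by auto
  show "clocked (I \<union> J) (L * L) (h i) (e i)" if "i < 2 * v" for i
  proof (cases "i < v")
    case True
    show ?thesis using clocked_double[OF f(2) f' g(2) g' disj L, OF True True True True] True
      by (simp add: h_def e_def s_def)
  next
    case False
    then have "i - v < v" using that by auto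
    from clocked_double[OF g(2) g' f(2) f' _ L, OF this this this this] disj False show ?thesis
      by (simp add: h_def e_def s_def add.commute Int_commute Un_commute)
  qed
  have cg: "c i (g i x) = c i x" and df: "d i (f i x) = d i x" if "i < v" for i x
    using f(2)[OF that] g(2)[OF that] f'[OF that, of x] g'[OF that, of x] disj
    unfolding clocked_def by (metis disjoint_iff)+
  have sf: "s i (f i x) mod L = Suc (s i x) mod L" and sg: "s i (g i x) mod L = Suc (s i x) mod L"
    if "i < v" for i x
    using f(2)[OF that] g(2)[OF that] cg[OF that] df[OF that]
    by (simp_all add: s_def clocked_def mod_simps)
  have I: "{x, f i x} \<in> cube_edges I" and J: "{x, g i x} \<in> cube_edges J" if "i < v" for i x
    using f'[OF that, of x] g'[OF that, of x] by auto
  note IJ = cube_edges_disjoint[OF disj]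
  show "orients (I \<union> J) (2 * v) h"
  proof (rule orientsI)
    fix i assume i: "i < 2 * v"
    show "bij (h i)"
    proof (cases "i < v")
      case True
      have "bij (\<lambda>x. if s i x mod L = 0 then g i x else f i x)"
        using orients_bij f(1) g(1) True sf sg L by (intro bij_switch) auto
      then show ?thesis using True by (simp add: h_def)
    next
      case False
      then have k: "i - v < v" using i by auto
      have "bij (\<lambda>x. if s (i - v) x mod L = 0 then f (i - v) x else g (i - v) x)"
        using orients_bij f(1) g(1) k sf sg L by (intro bij_switch) auto
      then show ?thesis using False by (simp add: h_def)
    qed
    show "\<exists>d\<in>I \<union> J. h i x = flip d x" for x
    proof (cases "i < v")
      case True
      then show ?thesis using f'[of i x] g'[of i x] by (auto simp: h_def)
    next
      case False
      then have "i - v < v" using i by auto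
      then show ?thesis using False f'[of "i - v" x] g'[of "i - v" x] by (auto simp: h_def)
    qed
  next
    \<comment> \<open>The step itself, given by \<open>k\<close> and the choice between
      \<open>f k\<close> and \<open>g k\<close>, determines the index \<open>i\<close> through the
      residue of \<open>s k\<close> at its start. Injectivity thus reduces to that of
      \<open>f\<close> and \<open>g\<close>.\<close>
    have hf: "\<exists>k<v. (h i x = f k x \<and> i = (if s k x mod L = 0 then v + k else k)) \<or>
        (h i x = g k x \<and> i = (if s k x mod L = 0 then k else v + k))" if "i < 2 * v" for i x
      using that by (intro exI[of _ "if i < v then i else i - v"]) (auto simp: h_def)
    fix i j x y assume i: "i < 2 * v" and j: "j < 2 * v" and eq: "{x, h i x} = {y, h j y}"
    obtain k where k: "k < v" "(h i x = f k x \<and> i = (if s k x mod L = 0 then v + k else k)) \<or>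
        (h i x = g k x \<and> i = (if s k x mod L = 0 then k else v + k))"
      using hf[OF i, of x] by (elim exE conjE)
    obtain l where l: "l < v" "(h j y = f l y \<and> j = (if s l y mod L = 0 then v + l else l)) \<or>
        (h j y = g l y \<and> j = (if s l y mod L = 0 then l else v + l))"
      using hf[OF j, of y] by (elim exE conjE)
    show "i = j \<and> x = y"
      using k(2) l(2)
    proof (elim disjE conjE)
      assume a: "h i x = f k x" "h j y = f l y"
        "i = (if s k x mod L = 0 then v + k else k)" "j = (if s l y mod L = 0 then v + l else l)"
      then have "k = l \<and> x = y" using orients_inj[OF f(1) k(1) l(1), of x y] eq by simp
      then show ?thesis using a by simp
    next
      assume a: "h i x = g k x" "h j y = g l y"
        "i = (if s k x mod L = 0 then k else v + k)" "j = (if s l y mod L = 0 then l else v + l)"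
      then have "k = l \<and> x = y" using orients_inj[OF g(1) k(1) l(1), of x y] eq by simp
      then show ?thesis using a by simp
    next
      assume "h i x = f k x" "h j y = g l y"
      then show ?thesis using I[OF k(1), of x] J[OF l(1), of y] eq IJ by (metis disjoint_iff)
    next
      assume "h i x = g k x" "h j y = f l y"
      then show ?thesis using J[OF k(1), of x] I[OF l(1), of y] eq IJ by (metis disjoint_iff)
    qed
  next
    fix b x assume "b \<in> I \<union> J"
    then show "\<exists>i<2 * v. \<exists>y. {x, flip b x} = {y, h i y}"
    proof
      assume "b \<in> I"
      then obtain i y where "i < v" "{x, flip b x} = {y, f i y}" using orients_surj[OF f(1)] by metis
      then show ?thesis
        by (intro exI[of _ "if s i y mod L = 0 then v + i else i"] conjI exI[of _ y]) (simp_all add: h_def)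
    next
      assume "b \<in> J"
      then obtain i y where "i < v" "{x, flip b x} = {y, g i y}" using orients_surj[OF g(1)] by metis
      then show ?thesis
        by (intro exI[of _ "if s i y mod L = 0 then i else v + i"] conjI exI[of _ y]) (simp_all add: h_def)
    qed
  qed
qed

text \<open>Doubling starts from the 4-cycles of one pair of directions. Every doubling squares the
  modulus, hence the exponent \<open>2 ^ j\<close>; the offset \<open>l\<close> is arbitrary because
  the second half of a block is a translate of the first.\<close>

lemma clocked_orients_power:
  "\<exists>f c. orients {l..<l + 2 * 2 ^ j} (2 ^ j) f \<and>
     (\<forall>i<2 ^ j. clocked {l..<l + 2 * 2 ^ j} (4 ^ 2 ^ j) (f i) (c i))"
proof (induction j arbitrary: l)
  case 0
  obtain c where "clocked {l, Suc l} 4 (rot l) c" using clocked_rot by blast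
  moreover have "{l..<l + 2 * 2 ^ 0} = {l, Suc l}" by auto
  ultimately show ?case using orients_rot[of l] by (intro exI[of _ "\<lambda>_. rot l"] exI[of _ "\<lambda>_. c"]) simp
next
  case (Suc j)
  let ?I = "{l..<l + 2 * 2 ^ j}" and ?J = "{l + 2 * 2 ^ j..<l + 2 * 2 ^ j + 2 * 2 ^ j}"
  obtain f c where f: "orients ?I (2 ^ j) f" "\<And>i. i < 2 ^ j \<Longrightarrow> clocked ?I (4 ^ 2 ^ j) (f i) (c i)"
    using Suc.IH[of l] by metis
  obtain g d where g: "orients ?J (2 ^ j) g" "\<And>i. i < 2 ^ j \<Longrightarrow> clocked ?J (4 ^ 2 ^ j) (g i) (d i)"
    using Suc.IH[of "l + 2 * 2 ^ j"] by metis
  have "?I \<inter> ?J = {}" by auto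
  moreover have "(1 :: nat) < 4 ^ 2 ^ j" by (rule one_less_power) auto
  moreover have "?I \<union> ?J = {l..<l + 2 * 2 ^ Suc j}" by auto
  moreover have "(4 :: nat) ^ 2 ^ j * 4 ^ 2 ^ j = 4 ^ 2 ^ Suc j" by (simp add: mult_2 power_add)
  ultimately show ?case using clocked_orients_double[OF f g] by simp
qed

section \<open>Cutting clocked orbits into paths\<close>

lemma clocked_mod:
  assumes "clocked I L f c" "M dvd L" "M > 0"
  shows "clocked I M f (\<lambda>x. c x mod M)"
  using assms unfolding clocked_def by (simp add: mod_mod_cancel mod_Suc_eq)

text \<open>Every orbit is cut at the points whose clock is divisible by \<open>N\<close>. The
  modulus \<open>2 * N\<close> instead of \<open>N\<close> keeps the two ends of a piece of length
  \<open>N\<close> apart, so that it is a path and not a cycle.\<close>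

lemma decomposable_clocked:
  assumes f: "bij f" "inj (\<lambda>x. {x, f x})" and c: "clocked I (2 * N) f c" and N: "N > 0"
  shows "decomposable (range (\<lambda>x. {x, f x})) N"
proof -
  let ?S = "{x. c x mod N = 0}"
  have cf: "c ((f ^^ j) x) = (c x + j) mod (2 * N)" for j x
    using c by (induction j) (auto simp: clocked_def mod_Suc_eq)
  have cN: "c ((f ^^ j) x) mod N = (c x + j) mod N" for j x
    unfolding cf by (simp add: mod_mod_cancel)
  have "decomposable ((\<lambda>(x, j). {(f ^^ j) x, (f ^^ Suc j) x}) ` (?S \<times> {..<N})) N"
  proof (rule decomposable_walks)
    show "inj_on (\<lambda>j. (f ^^ j) x) {..N}" for x
    proof (rule inj_onI)
      fix i j assume ij: "i \<in> {..N}" "j \<in> {..N}" "(f ^^ i) x = (f ^^ j) x"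
      then have "(c x + i) mod (2 * N) = (c x + j) mod (2 * N)" using cf by metis
      then have "i mod (2 * N) = j mod (2 * N)" by (simp add: nat_mod_eq_iff)
      then show "i = j" using ij N by simp
    qed
    show "inj_on (\<lambda>(x, j). {(f ^^ j) x, (f ^^ Suc j) x}) (?S \<times> {..<N})"
    proof (rule inj_onI)
      fix p q
      assume "p \<in> ?S \<times> {..<N}" "q \<in> ?S \<times> {..<N}"
        and "(\<lambda>(x, j). {(f ^^ j) x, (f ^^ Suc j) x}) p = (\<lambda>(x, j). {(f ^^ j) x, (f ^^ Suc j) x}) q"
      then obtain x i y j where pq: "p = (x, i)" "q = (y, j)"
        and xy: "c x mod N = 0" "c y mod N = 0" "i < N" "j < N"
        and eq: "{(f ^^ i) x, f ((f ^^ i) x)} = {(f ^^ j) y, f ((f ^^ j) y)}"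
        by (cases p, cases q) auto
      have "(f ^^ i) x = (f ^^ j) y" using injD[OF f(2) eq] .
      then have "(c x + i) mod N = (c y + j) mod N" using cN by metis
      then have "i = j" using xy by (metis add_0 mod_add_left_eq mod_less)
      moreover from this have "x = y"
        using \<open>(f ^^ i) x = (f ^^ j) y\<close> bij_is_inj[OF f(1)] by (metis inj_fn injD)
      ultimately show "p = q" using pq by simp
    qed
  qed
  moreover have "(\<lambda>(x, j). {(f ^^ j) x, (f ^^ Suc j) x}) ` (?S \<times> {..<N}) = range (\<lambda>x. {x, f x})"
  proof (intro equalityI subsetI)
    fix e assume "e \<in> range (\<lambda>x. {x, f x})"
    then obtain y where y: "e = {y, f y}" by auto
    \<comment> \<open>Going back \<open>j\<close> steps from \<open>y\<close> leads to the start of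
      the piece that contains the edge leaving \<open>y\<close>.\<close>
    define j where "j = c y mod N"
    obtain x where x: "y = (f ^^ j) x" using bij_fn[OF f(1)] by (metis bij_pointE)
    have "(c x + j) mod N = j mod N"
      unfolding cN[of j x, symmetric] x[symmetric] by (simp add: j_def)
    then have "c x mod N = 0" using mod_eq_dvd_iff_nat[of j "c x + j" N] by simp
    then show "e \<in> (\<lambda>(x, j). {(f ^^ j) x, (f ^^ Suc j) x}) ` (?S \<times> {..<N})"
      using x y N by (intro image_eqI[of _ _ "(x, j)"]) (simp_all add: j_def)
  qed auto
  ultimately show ?thesis by simp
qed

lemma decomposable_cube_block:
  assumes "orients I v f" "\<And>i. i < v \<Longrightarrow> clocked I (2 * N) (f i) (c i)" "N > 0"
  shows "decomposable (cube_edges I) N"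
proof -
  have "cube_edges I = (\<lambda>(i, y). {y, f i y}) ` ({..<v} \<times> UNIV)"
    using assms(1) by (simp add: orients_def bij_betw_def)
  also have "\<dots> = (\<Union>i\<in>{..<v}. range (\<lambda>y. {y, f i y}))" by auto
  finally have "cube_edges I = (\<Union>i\<in>{..<v}. range (\<lambda>y. {y, f i y}))" .
  moreover have "decomposable (\<Union>i\<in>{..<v}. range (\<lambda>y. {y, f i y})) N"
  proof (rule decomposable_UN)
    fix i assume "i \<in> {..<v}"
    then have i: "i < v" by simp
    have "inj (\<lambda>x. {x, f i x})"
    proof (rule injI)
      fix x y assume "{x, f i x} = {y, f i y}"
      from orients_inj[OF assms(1) i i this] show "x = y" by simp
    qed
    from decomposable_clocked[OF orients_bij[OF assms(1) i] this assms(2)[OF i] assms(3)]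
    show "decomposable (range (\<lambda>y. {y, f i y})) N" .
  next
    show "disjoint_family_on (\<lambda>i. range (\<lambda>y. {y, f i y})) {..<v}"
      unfolding disjoint_family_on_def using orients_inj[OF assms(1)] by fastforce
  qed
  ultimately show ?thesis by simp
qed

section \<open>Paths within a layer\<close>

text \<open>\<open>A j x\<close> is the position at time \<open>j\<close> on a path of length
  \<open>a\<close> from \<open>x\<close>; there is one such path per vertex and they share no edge.
  They are only parts of the final paths, whereas the edges left over already decompose into full
  paths of length \<open>N\<close>.\<close>

definition layer_walk :: "nat set \<Rightarrow> nat \<Rightarrow> nat \<Rightarrow> (nat \<Rightarrow> nat set \<Rightarrow> nat set) \<Rightarrow> bool" where
  "layer_walk I a N A \<longleftrightarrow> (\<forall>x. A 0 x = x) \<and> (\<forall>j\<le>a. bij (A j)) \<and> (\<forall>x. inj_on (\<lambda>j. A j x) {..a}) \<and>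
     (\<forall>j<a. \<forall>x. \<exists>d\<in>I. A (Suc j) x = flip d (A j x)) \<and>
     inj_on (\<lambda>(x, j). {A j x, A (Suc j) x}) (UNIV \<times> {..<a}) \<and>
     decomposable (cube_edges I - (\<lambda>(x, j). {A j x, A (Suc j) x}) ` (UNIV \<times> {..<a})) N"

lemma orients_extend:
  assumes f: "orients {..<2 * v} v f" and "v \<le> t"
  shows "orients {..<2 * t} t (\<lambda>i. if i < v then f i else rot (2 * i))"
  using \<open>v \<le> t\<close>
proof (induction t rule: dec_induct)
  case base
  show ?case by (rule orients_cong[OF f]) simp
next
  case (step t)
  have "{..<2 * t} \<inter> {2 * t, Suc (2 * t)} = {}" by auto
  from orients_Un[OF step.IH orients_rot this]
  have "orients ({..<2 * t} \<union> {2 * t, Suc (2 * t)}) (t + 1)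
    (\<lambda>i. if i < t then if i < v then f i else rot (2 * i) else rot (2 * t))" .
  moreover have "{..<2 * t} \<union> {2 * t, Suc (2 * t)} = {..<2 * Suc t}" by auto
  ultimately have "orients {..<2 * Suc t} (Suc t) (\<lambda>i. if i < t then if i < v then f i else rot (2 * i) else rot (2 * t))"
    by simp
  then show ?case by (rule orients_cong) (use step.hyps in \<open>auto simp: less_Suc_eq\<close>)
qed

lemma Diff_eqI: "X = Y \<union> R \<Longrightarrow> Y \<inter> R = {} \<Longrightarrow> X - R = Y"
  by blast

text \<open>
  An order of the maps \<open>u, \<dots>, t - 1\<close> without two consecutive ones from the clocked block (indices
  below \<open>v\<close>). The remaining maps use pairwise disjoint pairs of directions, so walks following this
  order never return to a vertex.
\<close>

lemma alternating_order:
  fixes u v t :: nat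
  assumes "u \<le> v" "v \<le> t" "2 * v \<le> t + u + 1"
  shows "\<exists>p. bij_betw p {..<t - u} {u..<t} \<and> (\<forall>j. Suc j < t - u \<longrightarrow> v \<le> p j \<or> v \<le> p (Suc j))"
proof -
  \<comment> \<open>The clocked maps \<open>u, ..., v - 1\<close> take the even places below
    \<open>2 * (v - u)\<close>, and the maps from \<open>v\<close> on fill all other places in
    increasing order. The assumption on \<open>t\<close> provides the \<open>v - u - 1\<close>
    separators needed.\<close>
  define p where "p j = (if j < 2 * (v - u) then if even j then u + j div 2 else v + j div 2
    else v + (j - (v - u)))" for j
  obtain g where g: "v = u + g" using \<open>u \<le> v\<close> le_Suc_ex by blast
  have cases: "\<exists>k. (j = 2 * k \<and> k < g \<and> p j = u + k) \<or> (j = Suc (2 * k) \<and> k < g \<and> p j = v + k) \<or>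
      (j = k + g \<and> g \<le> k \<and> p j = v + k)" for j
  proof (cases "j < 2 * g")
    case True
    then show ?thesis by (cases "even j") (auto simp: p_def g elim!: evenE oddE)
  next
    case False
    then have "j = (j - g) + g \<and> g \<le> j - g \<and> p j = v + (j - g)" by (simp add: p_def g)
    then show ?thesis by blast
  qed
  have inj: "inj_on p {..<t - u}"
  proof (rule inj_onI)
    fix i j assume "p i = p j"
    then show "i = j" using cases[of i] cases[of j] g by (elim exE disjE conjE) linarith+
  qed
  have "p ` {..<t - u} \<subseteq> {u..<t}"
  proof
    fix k assume "k \<in> p ` {..<t - u}"
    then obtain j where "j < t - u" "k = p j" by auto
    then have "u \<le> k \<and> k < t" using cases[of j] g assms by (elim exE disjE conjE) linarith+
    then show "k \<in> {u..<t}" by simp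
  qed
  then have "p ` {..<t - u} = {u..<t}"
    using inj by (intro card_subset_eq) (simp_all add: card_image)
  moreover have "v \<le> p j \<or> v \<le> p (Suc j)" for j
    using assms by (auto simp: p_def)
  ultimately show ?thesis using inj unfolding bij_betw_def by blast
qed

text \<open>The walks apply the maps \<open>u, ..., t - 1\<close> in the alternating order. The maps
  below \<open>u\<close> are left over; they are clocked, so their orbits can be cut into paths of
  length \<open>N\<close>.\<close>

lemma layer_walk_exists:
  assumes f: "orients {..<2 * v} v f"
    and c: "\<And>i. i < v \<Longrightarrow> clocked {..<2 * v} (2 * N) (f i) (c i)"
    and N: "N > 0" and uvt: "u \<le> v" "v \<le> t" "2 * v \<le> t + u + 1"
  shows "\<exists>A. layer_walk {..<2 * t} (t - u) N A"
proof -
  define F where "F i = (if i < v then f i else rot (2 * i))" for i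
  define a where "a = t - u"
  have F: "orients {..<2 * t} t F" using orients_extend[OF f uvt(2)] unfolding F_def .
  obtain p where p: "bij_betw p {..<a} {u..<t}"
    and alt: "\<And>j. Suc j < a \<Longrightarrow> v \<le> p j \<or> v \<le> p (Suc j)"
    using alternating_order[OF uvt] unfolding a_def by metis
  have pt: "u \<le> p j" "p j < t" if "j < a" for j
    using p that unfolding bij_betw_def by auto
  have p_inj: "p i = p j \<longleftrightarrow> i = j" if "i < a" "j < a" for i j
    using p that unfolding bij_betw_def by (auto dest: inj_onD)
  define A where "A = rec_nat id (\<lambda>j h. F (p j) \<circ> h)"
  have A0: "A 0 x = x" and AS: "A (Suc j) x = F (p j) (A j x)" for j x by (simp_all add: A_def)
  have bij: "bij (A j)" if "j \<le> a" for j
    using that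
  proof (induction j)
    case 0
    then show ?case using bij_id by (simp add: A_def id_def)
  next
    case (Suc j)
    then have "bij (F (p j) \<circ> A j)" using pt[of j] by (intro bij_comp orients_bij[OF F]) simp_all
    then show ?case by (simp add: A_def comp_def)
  qed
  have flips: "\<exists>d\<in>{..<2 * t}. A (Suc j) x = flip d (A j x)" if "j < a" for j x
    using orients_flip[OF F pt(2)[OF that]] unfolding AS .
  have edge_inj: "i = j \<and> x = y" if "i < a" "j < a" "{A i x, A (Suc i) x} = {A j y, A (Suc j) y}" for i j x y
  proof -
    have "p i = p j \<and> A i x = A j y"
      using orients_inj[OF F, of "p i" "p j" "A i x" "A j y"] pt that by (simp add: AS)
    moreover from this have "i = j" using p_inj that by simp
    ultimately have "i = j" "A i x = A i y" by simp_all
    then show ?thesis using bij[of i] that by (metis bij_is_inj injD less_imp_le)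
  qed
  have dist: "inj_on (\<lambda>j. A j x) {..a}" for x
  proof -
    \<comment> \<open>Consecutive vertices differ by a flip. Otherwise some step \<open>e\<close> in
      between applies an unclocked map; no other step touches its pair \<open>D\<close> of
      directions, so the two vertices differ on \<open>D\<close>.\<close>
    have distinct: "A i x \<noteq> A j x" if ij: "i < j" "j \<le> a" for i j
    proof (cases "j = Suc i")
      case True
      then show ?thesis using flips[of i x] ij by auto
    next
      case False
      then have "Suc i < j" using ij by simp
      then obtain e where e: "i \<le> e" "e < j" "v \<le> p e"
      proof -
        have "v \<le> p i \<or> v \<le> p (Suc i)" using alt[of i] \<open>Suc i < j\<close> ij by simp
        then show ?thesis using that[of i] that[of "Suc i"] \<open>Suc i < j\<close> by auto
      qed
      define D where "D = {2 * p e, Suc (2 * p e)}"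
      have keep: "A (Suc m) x \<inter> D = A m x \<inter> D" if m: "m < a" "m \<noteq> e" for m
      proof -
        have pm: "p m \<noteq> p e" using p_inj[of m e] m e ij by simp
        obtain d where d: "A (Suc m) x = flip d (A m x)" "d \<notin> D"
        proof (cases "p m < v")
          case True
          then obtain d where "d < 2 * v" "A (Suc m) x = flip d (A m x)"
            using orients_flip[OF f True, of "A m x"] by (auto simp: AS F_def)
          then show ?thesis using that[of d] e by (auto simp: D_def)
        next
          case False
          then have "A (Suc m) x = rot (2 * p m) (A m x)" by (simp add: AS F_def)
          moreover have "2 * p m \<notin> D" "Suc (2 * p m) \<notin> D"
            using pm unfolding D_def insert_iff empty_iff by presburger+
          ultimately show ?thesis
            using that[of "2 * p m"] that[of "Suc (2 * p m)"] rot_flips[of "2 * p m" "A m x"] by simp metis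
        qed
        then show ?thesis by (simp add: flip_Int)
      qed
      have "A (Suc e) x \<inter> D \<noteq> A e x \<inter> D"
      proof -
        have "A (Suc e) x = rot (2 * p e) (A e x)" using e by (simp add: AS F_def)
        then obtain d where "A (Suc e) x = flip d (A e x)" "d \<in> D"
          using rot_flips[of "2 * p e" "A e x"] unfolding D_def by blast
        then show ?thesis by (simp add: flip_Int_neq)
      qed
      moreover have "A e x \<inter> D = A i x \<inter> D"
      proof -
        have "m \<le> e \<Longrightarrow> A m x \<inter> D = A i x \<inter> D" if "i \<le> m" for m
          using that
        proof (induction m rule: dec_induct)
          case (step m)
          then show ?case using keep[of m] e ij by simp
        qed simp
        from this[OF e(1) order_refl] show ?thesis .
      qed
      moreover have "A j x \<inter> D = A (Suc e) x \<inter> D"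
      proof -
        have "m \<le> a \<Longrightarrow> A m x \<inter> D = A (Suc e) x \<inter> D" if "Suc e \<le> m" for m
          using that
        proof (induction m rule: dec_induct)
          case (step m)
          then show ?case using keep[of m] by simp
        qed simp
        from this[of j] show ?thesis using e ij by (meson Suc_leI)
      qed
      ultimately show ?thesis by metis
    qed
    show "inj_on (\<lambda>j. A j x) {..a}"
    proof (rule inj_onI)
      fix i j assume "i \<in> {..a}" "j \<in> {..a}" "A i x = A j x"
      then show "i = j" using distinct[of i j] distinct[of j i] by (cases i j rule: linorder_cases) auto
    qed
  qed
  have einj: "inj_on (\<lambda>(x, j). {A j x, A (Suc j) x}) (UNIV \<times> {..<a})"
  proof (rule inj_onI)
    fix q r
    assume "q \<in> UNIV \<times> {..<a}" "r \<in> UNIV \<times> {..<a}"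
      and "(\<lambda>(x, j). {A j x, A (Suc j) x}) q = (\<lambda>(x, j). {A j x, A (Suc j) x}) r"
    then show "q = r" using edge_inj[of "snd q" "snd r" "fst q" "fst r"]
      by (simp add: case_prod_beta prod_eq_iff mem_Times_iff)
  qed
  have dec: "decomposable (cube_edges {..<2 * t} - (\<lambda>(x, j). {A j x, A (Suc j) x}) ` (UNIV \<times> {..<a})) N"
  proof -
    have "(\<lambda>(x, j). {A j x, A (Suc j) x}) ` (UNIV \<times> {..<a}) = (\<Union>i\<in>{u..<t}. range (\<lambda>y. {y, F i y}))"
      (is "?L = ?R")
    proof
      show "?L \<subseteq> ?R"
      proof
        fix E assume "E \<in> ?L"
        then obtain x j where "j < a" "E = {A j x, A (Suc j) x}" by auto
        then show "E \<in> ?R" using pt[of j] by (intro UN_I[of "p j"]) (auto simp: AS)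
      qed
      show "?R \<subseteq> ?L"
      proof
        fix E assume "E \<in> ?R"
        then obtain i y where i: "i \<in> {u..<t}" "E = {y, F i y}" by auto
        then have "i \<in> p ` {..<a}" using p by (simp add: bij_betw_def)
        then obtain j where j: "j < a" "i = p j" by auto
        obtain x where "y = A j x" using bij[of j] j by (metis bij_pointE less_imp_le)
        then show "E \<in> ?L" using i j by (intro image_eqI[of _ _ "(x, j)"]) (simp_all add: AS)
      qed
    qed
    moreover have "cube_edges {..<2 * t} = (\<Union>i\<in>{..<t}. range (\<lambda>y. {y, F i y}))"
    proof -
      have "cube_edges {..<2 * t} = (\<lambda>(i, y). {y, F i y}) ` ({..<t} \<times> UNIV)"
        using F by (simp add: orients_def bij_betw_def)
      also have "\<dots> = (\<Union>i\<in>{..<t}. range (\<lambda>y. {y, F i y}))" by auto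
      finally show ?thesis .
    qed
    moreover have disj: "disjoint_family_on (\<lambda>i. range (\<lambda>y. {y, F i y})) {..<t}"
      unfolding disjoint_family_on_def using orients_inj[OF F] by fastforce
    ultimately have "cube_edges {..<2 * t} - ?L = (\<Union>i\<in>{..<u}. range (\<lambda>y. {y, F i y}))" (is "_ = ?Y")
    proof -
      assume L: "?L = (\<Union>i\<in>{u..<t}. range (\<lambda>y. {y, F i y}))"
        and E: "cube_edges {..<2 * t} = (\<Union>i\<in>{..<t}. range (\<lambda>y. {y, F i y}))"
      have "{..<t} = {..<u} \<union> {u..<t}" using uvt by auto
      then have 1: "cube_edges {..<2 * t} = ?Y \<union> (\<Union>i\<in>{u..<t}. range (\<lambda>y. {y, F i y}))"
        unfolding E by (simp only: UN_Un)
      have 2: "?Y \<inter> (\<Union>i\<in>{u..<t}. range (\<lambda>y. {y, F i y})) = {}"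
      proof -
        have "range (\<lambda>y. {y, F i y}) \<inter> range (\<lambda>y. {y, F j y}) = {}" if "i < u" "u \<le> j" "j < t" for i j
          using disj that unfolding disjoint_family_on_def by auto
        then show ?thesis by (simp add: Int_UN_distrib2)
      qed
      show ?thesis unfolding L by (rule Diff_eqI[OF 1 2])
    qed
    moreover have "decomposable ?Y N"
    proof (rule decomposable_UN)
      fix i assume "i \<in> {..<u}"
      then have i: "i < v" "F i = f i" using uvt by (auto simp: F_def)
      have "inj (\<lambda>x. {x, f i x})"
      proof (rule injI)
        fix x y assume "{x, f i x} = {y, f i y}"
        from orients_inj[OF f i(1) i(1) this] show "x = y" by simp
      qed
      from decomposable_clocked[OF orients_bij[OF f i(1)] this c[OF i(1)] N]
      show "decomposable (range (\<lambda>y. {y, F i y})) N" unfolding i(2) .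
    next
      show "disjoint_family_on (\<lambda>i. range (\<lambda>y. {y, F i y})) {..<u}"
        using disj uvt by (auto simp: disjoint_family_on_def)
    qed
    ultimately show ?thesis by simp
  qed
  have "layer_walk {..<2 * t} a N A"
    unfolding layer_walk_def by (intro conjI allI impI A0 bij dist flips einj dec)
  then show ?thesis unfolding a_def by blast
qed

section \<open>Paths whose length is a power of two\<close>

text \<open>Directions in \<open>I\<close> leave coordinate \<open>e\<close> alone, so no edge of
  \<open>X\<close> joins the two layers and the decomposition splits between them.\<close>

lemma decomposable_side:
  assumes dec: "decomposable X k" and X: "X \<subseteq> cube_edges I" and e: "e \<notin> I"
  shows "decomposable {E \<in> X. E \<subseteq> {x. (e \<in> x) = b}} k"
proof -
  have "y \<in> {x. (e \<in> x) = b}" if "{x, y} \<in> X" "x \<in> {x. (e \<in> x) = b}" for x y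
  proof -
    from that have "{x, y} \<in> cube_edges I" using X by blast
    then obtain d where "d \<in> I" "y = flip d x" using cube_edgeD by blast
    then show ?thesis using that e by auto
  qed
  then obtain P where "is_path_decomposition {x. (e \<in> x) = b} {E \<in> X. E \<subseteq> {x. (e \<in> x) = b}} k P"
    using decomposable_restrict[OF dec, of "{x. (e \<in> x) = b}"] by blast
  then show ?thesis by (rule is_path_decomposition_UNIV)
qed

text \<open>Coordinate \<open>e\<close> separates a lower layer, where the paths of \<open>A\<close>
  are used, from an upper layer with those of \<open>B\<close>. Each matching edge joins two such
  paths at their starting points; the leftover edges of each layer decompose by assumption.\<close>

lemma decomposable_join:
  assumes A: "layer_walk I a N A" and B: "layer_walk I b N B" and e: "e \<notin> I" and N: "a + b + 1 = N"
  shows "decomposable (cube_edges (insert e I)) N"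
proof -
  \<comment> \<open>The path of \<open>A\<close> is run backwards, reaching its start
    \<open>x\<close> at time \<open>a\<close>; edge number \<open>a\<close> crosses to
    \<open>flip e x\<close>, from where the path of \<open>B\<close> is followed.\<close>
  define W where "W x j = (if j \<le> a then A (a - j) x else B (j - Suc a) (flip e x))" for x j
  define EA where "EA = (\<lambda>(x, j). {A j x, A (Suc j) x}) ` (UNIV \<times> {..<a})"
  define EB where "EB = (\<lambda>(x, j). {B j x, B (Suc j) x}) ` (UNIV \<times> {..<b})"
  define EW where "EW = (\<lambda>(x, j). {W x j, W x (Suc j)}) ` ({x. e \<notin> x} \<times> {..<N})"
  have A0: "A 0 x = x" and A_bij: "j \<le> a \<Longrightarrow> bij (A j)" and A_inj: "inj_on (\<lambda>j. A j x) {..a}"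
    and A_flip: "j < a \<Longrightarrow> \<exists>d\<in>I. A (Suc j) x = flip d (A j x)"
    and A_einj: "inj_on (\<lambda>(x, j). {A j x, A (Suc j) x}) (UNIV \<times> {..<a})"
    and A_dec: "decomposable (cube_edges I - EA) N" for x j
    using A unfolding layer_walk_def EA_def by (elim conjE; simp)+
  have B0: "B 0 x = x" and B_bij: "j \<le> b \<Longrightarrow> bij (B j)" and B_inj: "inj_on (\<lambda>j. B j x) {..b}"
    and B_flip: "j < b \<Longrightarrow> \<exists>d\<in>I. B (Suc j) x = flip d (B j x)"
    and B_einj: "inj_on (\<lambda>(x, j). {B j x, B (Suc j) x}) (UNIV \<times> {..<b})"
    and B_dec: "decomposable (cube_edges I - EB) N" for x j
    using B unfolding layer_walk_def EB_def by (elim conjE; simp)+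
  have eA: "e \<in> A j x \<longleftrightarrow> e \<in> x" if "j \<le> a" for j x
    using that
  proof (induction j)
    case (Suc j)
    then obtain d where "d \<in> I" "A (Suc j) x = flip d (A j x)" using A_flip[of j x] by auto
    moreover from this have "e \<noteq> d" using e by blast
    ultimately show ?case using Suc by simp
  qed (simp add: A0)
  have eB: "e \<in> B j x \<longleftrightarrow> e \<in> x" if "j \<le> b" for j x
    using that
  proof (induction j)
    case (Suc j)
    then obtain d where "d \<in> I" "B (Suc j) x = flip d (B j x)" using B_flip[of j x] by auto
    moreover from this have "e \<noteq> d" using e by blast
    ultimately show ?case using Suc by simp
  qed (simp add: B0)
  have eW: "e \<in> W x j \<longleftrightarrow> a < j" if "e \<notin> x" "j \<le> N" for x j
    using that eA[of "a - j" x] eB[of "j - Suc a" "flip e x"] N by (auto simp: W_def)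
  have lower: "{W x j, W x (Suc j)} = {A (a - Suc j) x, A (Suc (a - Suc j)) x}" if "j < a" for x j
    using that by (simp add: W_def insert_commute Suc_diff_Suc)
  have middle: "{W x a, W x (Suc a)} = {x, flip e x}" for x
    by (simp add: W_def A0 B0)
  have upper: "{W x j, W x (Suc j)} = {B (j - Suc a) (flip e x), B (Suc (j - Suc a)) (flip e x)}"
    if "a < j" for x j
    using that by (simp add: W_def Suc_diff_Suc)
  have "decomposable EW N"
    unfolding EW_def
  proof (rule decomposable_walks)
    fix x assume "x \<in> {x. e \<notin> x}"
    then have x: "e \<notin> x" by simp
    show "inj_on (W x) {..N}"
    proof (rule inj_onI)
      fix i j assume ij: "i \<in> {..N}" "j \<in> {..N}" "W x i = W x j"
      then have side: "a < i \<longleftrightarrow> a < j" using eW[OF x, of i] eW[OF x, of j] by simp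
      show "i = j"
      proof (cases "a < i")
        case True
        then have "i - Suc a = j - Suc a"
          using ij side N by (intro inj_onD[OF B_inj[of "flip e x"]]) (auto simp: W_def)
        then show ?thesis using True side by simp
      next
        case False
        then have "a - i = a - j"
          using ij side by (intro inj_onD[OF A_inj[of x]]) (auto simp: W_def)
        then show ?thesis using False side by simp
      qed
    qed
  next
    show "inj_on (\<lambda>(x, j). {W x j, W x (Suc j)}) ({x. e \<notin> x} \<times> {..<N})"
    proof (rule inj_onI)
      fix p q
      assume pq: "p \<in> {x. e \<notin> x} \<times> {..<N}" "q \<in> {x. e \<notin> x} \<times> {..<N}"
        and pq_eq: "(\<lambda>(x, j). {W x j, W x (Suc j)}) p = (\<lambda>(x, j). {W x j, W x (Suc j)}) q"
      obtain x i y j where p: "p = (x, i)" and q: "q = (y, j)" by (cases p, cases q)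
      have xy: "e \<notin> x" "e \<notin> y" "i < N" "j < N" using pq by (simp_all add: p q)
      have eq: "{W x i, W x (Suc i)} = {W y j, W y (Suc j)}"
        using pq_eq by (simp add: p q)
      \<comment> \<open>The layers of its two ends tell whether an edge is traversed before, at or
        after the crossing.\<close>
      have low: "(\<forall>z\<in>{W x i, W x (Suc i)}. e \<notin> z) \<longleftrightarrow> i < a" "(\<forall>z\<in>{W y j, W y (Suc j)}. e \<notin> z) \<longleftrightarrow> j < a"
        using eW[of x i] eW[of x "Suc i"] eW[of y j] eW[of y "Suc j"] xy by auto
      have high: "(\<forall>z\<in>{W x i, W x (Suc i)}. e \<in> z) \<longleftrightarrow> a < i" "(\<forall>z\<in>{W y j, W y (Suc j)}. e \<in> z) \<longleftrightarrow> a < j"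
        using eW[of x i] eW[of x "Suc i"] eW[of y j] eW[of y "Suc j"] xy by auto
      have side: "i < a \<longleftrightarrow> j < a" "a < i \<longleftrightarrow> a < j"
        using low high unfolding eq by simp_all
      consider "i < a" | "i = a" | "a < i" by linarith
      then show "p = q"
      proof cases
        case 1
        then have "j < a" using side by simp
        from eq[unfolded lower[OF 1] lower[OF this]]
        have "(x, a - Suc i) = (y, a - Suc j)" using 1 \<open>j < a\<close> by (intro inj_onD[OF A_einj]) simp_all
        then show ?thesis using 1 \<open>j < a\<close> unfolding p q by auto
      next
        case 2
        then have "j = a" using side by simp
        then have "{x, flip e x} = {y, flip e y}" using eq 2 by (simp add: middle)
        then have "x = y \<or> x = flip e y" unfolding flip_edge_eq_iff by simp
        then have "x = y" using xy by auto
        then show ?thesis using 2 \<open>j = a\<close> by (simp add: p q)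
      next
        case 3
        then have "a < j" using side by simp
        from eq[unfolded upper[OF 3] upper[OF this]]
        have "(flip e x, i - Suc a) = (flip e y, j - Suc a)"
          using 3 \<open>a < j\<close> xy N by (intro inj_onD[OF B_einj]) auto
        then show ?thesis using 3 \<open>a < j\<close> unfolding p q by auto
      qed
    qed
  qed
  define RA where "RA = {E \<in> cube_edges I - EA. E \<subseteq> {x. (e \<in> x) = False}}"
  define RB where "RB = {E \<in> cube_edges I - EB. E \<subseteq> {x. (e \<in> x) = True}}"
  have RA: "decomposable RA N" and RB: "decomposable RB N"
    unfolding RA_def RB_def
    by (rule decomposable_side[OF A_dec Diff_subset e], rule decomposable_side[OF B_dec Diff_subset e])
  have EW_cases: "E \<in> EW \<Longrightarrow> E \<in> EA \<and> (\<forall>z\<in>E. e \<notin> z) \<or> E \<in> EB \<and> (\<forall>z\<in>E. e \<in> z) \<or> E \<in> cube_edges {e}" for E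
  proof -
    assume "E \<in> EW"
    then obtain x j where x: "e \<notin> x" "j < N" and E: "E = {W x j, W x (Suc j)}" unfolding EW_def by auto
    consider "j < a" | "j = a" | "a < j" by linarith
    then show ?thesis
    proof cases
      case 1
      then have "E \<in> EA" unfolding E lower[OF 1] EA_def by (intro image_eqI[of _ _ "(x, a - Suc j)"]) auto
      then show ?thesis using 1 x eW[of x j] eW[of x "Suc j"] E by auto
    next
      case 2
      then show ?thesis unfolding E using middle[of x] by simp
    next
      case 3
      then have "E \<in> EB" unfolding E upper[OF 3] EB_def
        using x N by (intro image_eqI[of _ _ "(flip e x, j - Suc a)"]) auto
      then show ?thesis using 3 x eW[of x j] eW[of x "Suc j"] E by auto
    qed
  qed
  have nonempty: "E \<noteq> {}" if "E \<in> cube_edges J" for E J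
    using that by (auto simp: cube_edges_def)
  have EA_sub: "EA \<subseteq> cube_edges I"
  proof
    fix E assume "E \<in> EA"
    then obtain x j where "j < a" "E = {A j x, A (Suc j) x}" unfolding EA_def by auto
    then show "E \<in> cube_edges I" using A_flip[of j x] by auto
  qed
  have EB_sub: "EB \<subseteq> cube_edges I"
  proof
    fix E assume "E \<in> EB"
    then obtain x j where "j < b" "E = {B j x, B (Suc j) x}" unfolding EB_def by auto
    then show "E \<in> cube_edges I" using B_flip[of j x] by auto
  qed
  have eI: "cube_edges {e} \<inter> cube_edges I = {}" using e by (intro cube_edges_disjoint) auto
  have eq: "cube_edges (insert e I) = (EW \<union> RA) \<union> RB"
  proof
    have "EW \<subseteq> cube_edges {e} \<union> cube_edges I" using EW_cases EA_sub EB_sub by blast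
    then show "(EW \<union> RA) \<union> RB \<subseteq> cube_edges (insert e I)"
      using cube_edges_Un[of "{e}" I] by (auto simp: RA_def RB_def)
    show "cube_edges (insert e I) \<subseteq> (EW \<union> RA) \<union> RB"
    proof
      fix E assume "E \<in> cube_edges (insert e I)"
      then obtain x d where E: "E = {x, flip d x}" "d \<in> insert e I" unfolding cube_edges_def by auto
      show "E \<in> (EW \<union> RA) \<union> RB"
      proof (cases "d = e")
        case True
        define y where "y = (if e \<in> x then flip e x else x)"
        have "e \<notin> y" "E = {y, flip e y}" using E True by (auto simp: y_def)
        then have "E \<in> EW" unfolding EW_def
          using middle[of y] N by (intro image_eqI[of _ _ "(y, a)"]) auto
        then show ?thesis by simp
      next
        case False
        then have d: "d \<in> I" using E by simp
        then have EI: "E \<in> cube_edges I" using E by simp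
        have side: "\<forall>z\<in>E. e \<in> z \<longleftrightarrow> e \<in> x" using E False by simp
        show ?thesis
        proof (cases "e \<in> x")
          case True
          show ?thesis
          proof (cases "E \<in> EB")
            case EB: True
            then obtain y j where y: "j < b" "E = {B j y, B (Suc j) y}" unfolding EB_def by auto
            then have "e \<in> y" using side True eB[of j y] by auto
            have "{W (flip e y) (Suc (a + j)), W (flip e y) (Suc (Suc (a + j)))} = E"
              using upper[of "Suc (a + j)" "flip e y"] y by simp
            then have "E \<in> EW" unfolding EW_def using y N \<open>e \<in> y\<close>
              by (intro image_eqI[of _ _ "(flip e y, Suc (a + j))"]) auto
            then show ?thesis by simp
          next
            case False
            then have "E \<in> RB" using EI side True by (auto simp: RB_def)
            then show ?thesis by simp
          qed
        next
          case x: False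
          show ?thesis
          proof (cases "E \<in> EA")
            case True
            then obtain y j where y: "j < a" "E = {A j y, A (Suc j) y}" unfolding EA_def by auto
            then have "e \<notin> y" using side x eA[of j y] by auto
            have "{W y (a - Suc j), W y (Suc (a - Suc j))} = E"
              using lower[of "a - Suc j" y] y by (simp add: Suc_diff_Suc)
            then have "E \<in> EW" unfolding EW_def using y N \<open>e \<notin> y\<close>
              by (intro image_eqI[of _ _ "(y, a - Suc j)"]) auto
            then show ?thesis by simp
          next
            case False
            then have "E \<in> RA" using EI side x by (auto simp: RA_def)
            then show ?thesis by simp
          qed
        qed
      qed
    qed
  qed
  have "E \<notin> RA \<and> E \<notin> RB" if "E \<in> EW" for E
  proof -
    from EW_cases[OF that]
    consider "E \<in> EA" "\<forall>z\<in>E. e \<notin> z" | "E \<in> EB" "\<forall>z\<in>E. e \<in> z" | "E \<in> cube_edges {e}"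
      by blast
    then show ?thesis
    proof cases
      case 1
      then have "E \<noteq> {}" using EA_sub nonempty by blast
      then show ?thesis using 1 by (auto simp: RA_def RB_def)
    next
      case 2
      then have "E \<noteq> {}" using EB_sub nonempty by blast
      then show ?thesis using 2 by (auto simp: RA_def RB_def)
    next
      case 3
      then show ?thesis using eI by (auto simp: RA_def RB_def)
    qed
  qed
  moreover have "RA \<inter> RB = {}"
    using nonempty by (fastforce simp: RA_def RB_def)
  ultimately have "EW \<inter> RA = {}" "(EW \<union> RA) \<inter> RB = {}" by blast+
  then show ?thesis unfolding eq
    using \<open>decomposable EW N\<close> RA RB by (intro decomposable_Un)
qed

text \<open>Of the \<open>r\<close> maps to be reserved, \<open>u\<close> are taken in one layer and
  \<open>r - u\<close> in the other, so the joined paths have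
  \<open>(t - u) + (t - (r - u)) + 1 = N\<close> edges.\<close>

lemma decomposable_odd_cube_base:
  assumes f: "orients {..<2 * v} v f"
    and c: "\<And>i. i < v \<Longrightarrow> clocked {..<2 * v} (2 * N) (f i) (c i)"
    and N: "N > 0" "4 * v \<le> N + 4" "2 * v \<le> N"
    and t: "2 * t + 1 = N + r" "1 \<le> r" "r < 2 * v"
  shows "decomposable (cube_edges {..<2 * t + 1}) N"
proof -
  \<comment> \<open>From \<open>2 * t \<ge> N \<ge> 4 * v - 4\<close> follows
    \<open>t + 1 \<ge> 2 * v - 1\<close>, so the alternating order is available once
    \<open>u \<ge> 1\<close>.\<close>
  have upper: "\<exists>B. layer_walk {..<2 * t} (t - u) N B" if "1 \<le> u" "u \<le> v" "u \<le> r" for u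
    using that N t by (intro layer_walk_exists[OF f c]) auto
  \<comment> \<open>For a layer with no reserved map the bound may fall short by one; there the
    clocked block is taken empty and all pairs of directions are merely rotated.\<close>
  have empty: "orients {..<2 * 0} 0 f" by (simp add: orients_def bij_betw_def cube_edges_def)
  have "\<exists>u A B. u \<le> r \<and> layer_walk {..<2 * t} (t - u) N A \<and> layer_walk {..<2 * t} (t - (r - u)) N B \<and>
      u \<le> t \<and> r - u \<le> t"
  proof (cases "r \<le> v")
    case True
    obtain A where "layer_walk {..<2 * t} (t - 0) N A"
      using layer_walk_exists[OF empty, of N c 0 t] N by auto
    then show ?thesis using upper[of r] True t N by (intro exI[of _ 0]) auto
  next
    case False
    then show ?thesis using upper[of v] upper[of "r - v"] t N by (intro exI[of _ v]) auto
  qed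
  then obtain u A B where u: "u \<le> r" "u \<le> t" "r - u \<le> t"
    and AB: "layer_walk {..<2 * t} (t - u) N A" "layer_walk {..<2 * t} (t - (r - u)) N B" by blast
  have "decomposable (cube_edges (insert (2 * t) {..<2 * t})) N"
    using u t by (intro decomposable_join[OF AB]) auto
  moreover have "insert (2 * t) {..<2 * t} = {..<2 * t + 1}" by auto
  ultimately show ?thesis by simp
qed

text \<open>\<open>2 ^ j\<close> is the number \<open>v\<close> of maps in a clocked block for
  \<open>N = 2 ^ s\<close>. For \<open>N \<ge> 8\<close> it is \<open>N / 4\<close>; for
  \<open>N = 2\<close> and \<open>N = 4\<close> it is \<open>N / 2\<close>, which the summand
  \<open>4\<close> accommodates.\<close>

lemma block_size:
  assumes "s > 0"
  shows "\<exists>j. 2 * 2 ^ s dvd (4 :: nat) ^ 2 ^ j \<and> 4 * 2 ^ j \<le> (2 :: nat) ^ s + 4 \<and> 2 * 2 ^ j \<le> (2 :: nat) ^ s"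
proof -
  consider "s = 1" | "s = 2" | n where "s = n + 3" using assms that(3)[of "s - 3"] by linarith
  then show ?thesis
  proof cases
    case 1
    then show ?thesis by (intro exI[of _ 0]) simp
  next
    case 2
    then show ?thesis by (intro exI[of _ 1]) simp
  next
    case 3
    have "n + 4 \<le> 2 * 2 ^ (n + 1)" by (induction n) auto
    then have "(2 :: nat) ^ (n + 4) dvd 2 ^ (2 * 2 ^ (n + 1))" by (rule le_imp_power_dvd)
    also have "(2 :: nat) ^ (2 * 2 ^ (n + 1)) = 4 ^ 2 ^ (n + 1)" by (simp add: power_mult)
    finally have "2 * 2 ^ s dvd (4 :: nat) ^ 2 ^ (n + 1)" by (simp add: 3 power_add mult.commute)
    then show ?thesis by (intro exI[of _ "n + 1"]) (simp add: 3 power_add)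
  qed
qed

text \<open>Clocked blocks of \<open>2 * v\<close> directions are split off until fewer than
  \<open>N + 2 * v\<close> directions remain, which is the range of the base construction.\<close>

lemma decomposable_cube_power2:
  assumes s: "s > 0" and "odd n" "2 ^ s \<le> n"
  shows "decomposable (cube_edges {..<n}) (2 ^ s)"
proof -
  define N :: nat where "N = 2 ^ s"
  obtain j where j: "2 * N dvd 4 ^ 2 ^ j" "4 * 2 ^ j \<le> N + 4" "2 * 2 ^ j \<le> N"
    using block_size[OF s] unfolding N_def by blast
  define v :: nat where "v = 2 ^ j"
  have N: "N > 0" "even N" using s by (simp_all add: N_def)
  have v: "v > 0" "4 * v \<le> N + 4" "2 * v \<le> N" using j by (simp_all add: v_def)
  have block: "\<exists>f c. orients {l..<l + 2 * v} v f \<and>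
      (\<forall>i<v. clocked {l..<l + 2 * v} (2 * N) (f i) (c i))" for l
  proof -
    obtain f c where fc: "orients {l..<l + 2 * v} v f"
      "\<forall>i<v. clocked {l..<l + 2 * v} (4 ^ 2 ^ j) (f i) (c i)"
      using clocked_orients_power[of l j] unfolding v_def by blast
    have "\<forall>i<v. clocked {l..<l + 2 * v} (2 * N) (f i) (\<lambda>x. c i x mod (2 * N))"
      using fc(2) j(1) N by (auto intro!: clocked_mod)
    then show ?thesis using fc(1) by (intro exI[of _ f] exI[of _ "\<lambda>i x. c i x mod (2 * N)"]) simp
  qed
  have "N < n" using assms N unfolding N_def by (metis le_neq_implies_less)
  have "decomposable (cube_edges {..<n}) N"
    using \<open>odd n\<close> \<open>N < n\<close>
  proof (induction n rule: less_induct)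
    case (less n)
    show ?case
    proof (cases "n < N + 2 * v")
      case True
      obtain f c where f: "orients {..<2 * v} v f" "\<And>i. i < v \<Longrightarrow> clocked {..<2 * v} (2 * N) (f i) (c i)"
        using block[of 0] by (auto simp: atLeast0LessThan)
      obtain t where t: "n = 2 * t + 1" using less.prems by (elim oddE)
      show ?thesis unfolding t
      proof (rule decomposable_odd_cube_base[OF f N(1) v(2,3)])
        show "2 * t + 1 = N + (n - N)" "1 \<le> n - N" "n - N < 2 * v" using True less.prems t by auto
      qed
    next
      case False
      define m where "m = n - 2 * v"
      have m: "odd m" "m < n" "n = m + 2 * v" using less.prems False v by (auto simp: m_def)
      \<comment> \<open>Removing an even number of directions keeps the dimension odd, so it cannot
        hit the even number \<open>N\<close>.\<close>
      then have "N < m" using False N less.prems by (cases "m = N") auto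
      obtain f c where f: "orients {m..<m + 2 * v} v f"
        "\<And>i. i < v \<Longrightarrow> clocked {m..<m + 2 * v} (2 * N) (f i) (c i)"
        using block[of m] by blast
      have disj: "{..<m} \<inter> {m..<m + 2 * v} = {}" by auto
      have "decomposable (cube_edges {..<m} \<union> cube_edges {m..<m + 2 * v}) N"
        using less.IH[OF \<open>m < n\<close> \<open>odd m\<close> \<open>N < m\<close>] decomposable_cube_block[OF f N(1)]
          cube_edges_disjoint[OF disj] by (rule decomposable_Un)
      moreover have "{..<n} = {..<m} \<union> {m..<m + 2 * v}" using m by auto
      ultimately show ?thesis by (simp only: cube_edges_Un)
    qed
  qed
  then show ?thesis by (simp add: N_def)
qed

section \<open>Subdividing the edges of a cube\<close>

text \<open>
  The \<open>m * q\<close> directions form an array of \<open>m\<close> rows of length \<open>q\<close>, with the blocks as its columns.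
  The involution \<open>spread\<close> turns flipping direction \<open>l < q\<close> into flipping all of column \<open>l\<close>, and
  \<open>shift\<close> flips the first \<open>r\<close> entries of a column. The edge \<open>{y, flip l y}\<close> is replaced by the path
  that flips the entries of column \<open>l\<close> one by one, top down from the end that is even on the column;
  \<open>sub_edge\<close> is the edge with number \<open>r\<close> of this path.
\<close>

definition block :: "nat \<Rightarrow> nat \<Rightarrow> nat \<Rightarrow> nat set" where
  "block q m l = {b. b < m * q \<and> b mod q = l}"

definition spread :: "nat \<Rightarrow> nat \<Rightarrow> nat set \<Rightarrow> nat set" where
  "spread q m y = {b. (b \<in> y) \<noteq> (q \<le> b \<and> b < m * q \<and> b mod q \<in> y)}"

definition shift :: "nat \<Rightarrow> nat \<Rightarrow> nat \<Rightarrow> nat set \<Rightarrow> nat set" where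
  "shift q r l x = {b. (b \<in> x) \<noteq> (b mod q = l \<and> b div q < r)}"

definition even_at :: "nat \<Rightarrow> nat \<Rightarrow> nat \<Rightarrow> nat set \<Rightarrow> bool" where
  "even_at q m l x \<longleftrightarrow> even (card (x \<inter> block q m l))"

definition sub_edge :: "nat \<Rightarrow> nat \<Rightarrow> nat set \<Rightarrow> nat \<Rightarrow> nat \<Rightarrow> nat set set" where
  "sub_edge q m y l r = {shift q r l (spread q m y), flip (r * q + l) (shift q r l (spread q m y))}"

section \<open>Edges of the large cube as pieces of subdivided edges\<close>

lemma finite_block: "finite (block q m l)"
  by (rule finite_subset[of _ "{..<m * q}"]) (auto simp: block_def)

lemma block_eq: "l < q \<Longrightarrow> block q m l = (\<lambda>r. r * q + l) ` {..<m}"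
proof
  assume l: "l < q"
  show "block q m l \<subseteq> (\<lambda>r. r * q + l) ` {..<m}"
  proof
    fix b assume "b \<in> block q m l"
    then have "b div q < m" "b = b div q * q + l"
      using l by (auto simp: block_def less_mult_imp_div_less)
    then show "b \<in> (\<lambda>r. r * q + l) ` {..<m}" by blast
  qed
  show "(\<lambda>r. r * q + l) ` {..<m} \<subseteq> block q m l"
  proof
    fix b assume "b \<in> (\<lambda>r. r * q + l) ` {..<m}"
    then obtain r where r: "r < m" "b = r * q + l" by auto
    have "b < Suc r * q" using r l by simp
    also have "\<dots> \<le> m * q" using r by (intro mult_le_mono1) simp
    finally show "b \<in> block q m l" using r l by (simp add: block_def)
  qed
qed

lemma card_block: "l < q \<Longrightarrow> card (block q m l) = m"
  unfolding block_eq by (subst card_image) (auto simp: inj_on_def)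

text \<open>Row zero is kept and added modulo two to every other row, so a second application
  cancels the first.\<close>

lemma spread_spread [simp]: "spread q m (spread q m y) = y"
proof -
  have "b mod q \<in> spread q m y \<longleftrightarrow> b mod q \<in> y" if "q \<le> b" "b < m * q" for b
  proof -
    have "b mod q < q" using that by (cases "q = 0") auto
    then show ?thesis by (auto simp: spread_def)
  qed
  then show ?thesis unfolding spread_def[of q m "spread q m y"] by (auto simp: spread_def)
qed

lemma shift_shift [simp]: "shift q r l (shift q r l x) = x"
  by (auto simp: shift_def)

lemma shift_flip: "shift q r l (flip b x) = flip b (shift q r l x)"
  by (auto simp: shift_def)

lemma spread_flip:
  assumes "l < q" "m > 0"
  shows "spread q m (flip l y) = {b. (b \<in> spread q m y) \<noteq> (b \<in> block q m l)}"
proof -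
  have q: "l < m * q" using assms less_le_trans[of l q "m * q"] by simp
  have "b \<in> spread q m (flip l y) \<longleftrightarrow> (b \<in> spread q m y) \<noteq> (b \<in> block q m l)" for b
  proof (cases "b < q")
    case True
    then have "b \<in> block q m l \<longleftrightarrow> b = l" using q by (auto simp: block_def)
    then show ?thesis using True by (auto simp: spread_def)
  next
    case False
    then have "b \<noteq> l" using assms by simp
    then show ?thesis using False by (auto simp: spread_def block_def)
  qed
  then show ?thesis by blast
qed

lemma even_at_flip:
  assumes "b \<in> block q m l"
  shows "even_at q m l (flip b x) \<longleftrightarrow> \<not> even_at q m l x"
proof (cases "b \<in> x")
  case True
  then have "x \<inter> block q m l = insert b (flip b x \<inter> block q m l)" "b \<notin> flip b x \<inter> block q m l"
    using assms by auto
  then show ?thesis using finite_block[of q m l] by (simp add: even_at_def)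
next
  case False
  then have "flip b x \<inter> block q m l = insert b (x \<inter> block q m l)" "b \<notin> x \<inter> block q m l"
    using assms by auto
  then show ?thesis using finite_block[of q m l] by (simp add: even_at_def)
qed

text \<open>Complementing a column of odd length \<open>m\<close> changes the parity of its number
  of ones. Hence exactly one end of an edge is even on its column, which makes the subdivision of an
  unordered edge well defined.\<close>

lemma even_at_spread_flip:
  assumes "l < q" "odd m"
  shows "even_at q m l (spread q m (flip l y)) \<longleftrightarrow> \<not> even_at q m l (spread q m y)"
proof -
  let ?B = "block q m l" and ?x = "spread q m y"
  have "spread q m (flip l y) \<inter> ?B = ?B - ?x"
    using spread_flip[OF assms(1), of m y] odd_pos[OF assms(2)] by auto
  moreover have "card (?B - ?x) = m - card (?x \<inter> ?B)"
    using card_Diff_subset_Int[of ?B ?x] finite_block card_block[OF assms(1)] by (simp add: Int_commute)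
  moreover have "card (?x \<inter> ?B) \<le> m"
    using card_mono[OF finite_block, of "?x \<inter> ?B" q m l] card_block[OF assms(1)] by simp
  ultimately show ?thesis using assms(2) by (simp add: even_at_def)
qed

text \<open>The flipped direction gives \<open>l\<close> and \<open>r\<close>. If the ends were
  matched crosswise, \<open>spread q m y\<close> and \<open>spread q m y'\<close> would differ in
  one entry of the column and could not both be even there.\<close>

lemma sub_edge_inj:
  assumes eq: "sub_edge q m y l r = sub_edge q m y' l' r'"
    and lr: "l < q" "r < m" "l' < q"
    and ev: "even_at q m l (spread q m y)" "even_at q m l' (spread q m y')"
  shows "y = y' \<and> l = l'"
proof -
  let ?b = "r * q + l"
  note eq' = eq[unfolded sub_edge_def flip_edge_eq_iff]
  have b: "?b = r' * q + l'" using eq' by (rule conjunct1)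
  have cases: "shift q r l (spread q m y) = shift q r' l' (spread q m y') \<or>
      shift q r l (spread q m y) = flip ?b (shift q r' l' (spread q m y'))"
    using eq' by (rule conjunct2)
  have "l = ?b mod q" using lr by simp
  also have "\<dots> = l'" unfolding b using lr by simp
  finally have l: "l = l'" .
  then have r: "r = r'" using b lr by simp
  have "?b \<in> block q m l" using block_eq[OF lr(1)] lr by auto
  from cases show ?thesis
  proof
    assume "shift q r l (spread q m y) = shift q r' l' (spread q m y')"
    then have "spread q m y = spread q m y'" unfolding l r by (metis shift_shift)
    then show ?thesis using l by (metis spread_spread)
  next
    assume "shift q r l (spread q m y) = flip ?b (shift q r' l' (spread q m y'))"
    then have "shift q r l (shift q r l (spread q m y)) = shift q r l (flip ?b (shift q r l (spread q m y')))"
      unfolding l r by simp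
    then have "spread q m y = flip ?b (spread q m y')" by (simp add: shift_flip)
    then show ?thesis using even_at_flip[OF \<open>?b \<in> block q m l\<close>] ev l by metis
  qed
qed

text \<open>Undoing \<open>shift\<close> at the two ends of the edge gives two candidates for
  \<open>spread q m y\<close> that differ in one entry of the column, so one of them is
  even.\<close>

lemma sub_edge_surj:
  assumes "b < m * q"
  shows "\<exists>y l r. l < q \<and> r < m \<and> even_at q m l (spread q m y) \<and> {z, flip b z} = sub_edge q m y l r"
proof -
  define l r where "l = b mod q" and "r = b div q"
  have q: "q > 0" using assms by (cases "q = 0") auto
  have lr: "l < q" "r < m" "r * q + l = b"
    using assms q by (simp_all add: l_def r_def less_mult_imp_div_less)
  have b: "b \<in> block q m l" using assms by (simp add: block_def l_def)
  have sub: "{x, flip b x} = sub_edge q m (spread q m (shift q r l x)) l r" for x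
    by (simp add: sub_edge_def lr(3))
  show ?thesis
  proof (cases "even_at q m l (shift q r l z)")
    case True
    then show ?thesis using lr sub[of z] by (intro exI[of _ "spread q m (shift q r l z)"] exI[of _ l] exI[of _ r]) simp
  next
    case False
    then have "even_at q m l (shift q r l (flip b z))" using even_at_flip[OF b] by (simp add: shift_flip)
    moreover have "{z, flip b z} = sub_edge q m (spread q m (shift q r l (flip b z))) l r"
      using sub[of "flip b z"] by (simp add: insert_commute)
    ultimately show ?thesis using lr
      by (intro exI[of _ "spread q m (shift q r l (flip b z))"] exI[of _ l] exI[of _ r]) simp
  qed
qed

text \<open>The replaced edges fit together because both ends of the piece for an edge are the
  spread ends of that edge, whichever way it is run. Each row passes through its states in the order
  of \<open>p\<close>, which prevents repeated vertices.\<close>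

lemma subdivided_path:
  assumes m: "odd m" and p: "is_path_of_length UNIV (cube_edges {..<q}) K p"
  shows "\<exists>p'. is_path_of_length UNIV (cube_edges {..<m * q}) (m * K) p' \<and>
    path_edges p' = {sub_edge q m y l r | y l r. l < q \<and> r < m \<and>
      even_at q m l (spread q m y) \<and> {y, flip l y} \<in> path_edges p}"
proof -
  define y where "y j = p ! j" for j
  have len: "length p = K + 1" and dist: "distinct p"
    and edge: "\<And>j. j < K \<Longrightarrow> {y j, y (Suc j)} \<in> cube_edges {..<q}"
    using p by (auto simp: is_path_of_length_def y_def)
  have "\<forall>j. \<exists>d. j < K \<longrightarrow> d < q \<and> y (Suc j) = flip d (y j)"
    using cube_edgeD[OF edge] by blast
  then obtain d where d: "\<And>j. j < K \<Longrightarrow> d j < q" "\<And>j. j < K \<Longrightarrow> y (Suc j) = flip (d j) (y j)"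
    by metis
  have m0: "m > 0" using odd_pos[OF m] .
  define x where "x j = spread q m (y j)" for j
  define ev where "ev j = even_at q m (d j) (x j)" for j
  have xS: "b \<in> x (Suc j) \<longleftrightarrow> (b \<in> x j) \<noteq> (b \<in> block q m (d j))" if "j < K" for j b
    unfolding x_def d(2)[OF that] spread_flip[OF d(1)[OF that] m0] by simp
  have evS: "even_at q m (d j) (x (Suc j)) \<longleftrightarrow> \<not> ev j" if "j < K" for j
    unfolding ev_def x_def d(2)[OF that] by (rule even_at_spread_flip[OF d(1)[OF that] m])
  \<comment> \<open>At time \<open>J\<close> row \<open>r\<close> of the subdivided path shows row \<open>r\<close> of \<open>x (\<tau> r J)\<close>.\<close>
  define \<tau> where "\<tau> r J = J div m +
    (if r < m \<and> (if ev (J div m) then r < J mod m else m \<le> r + J mod m) then 1 else 0)" for r J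
  define w where "w J = {b. b \<in> x (\<tau> (b div q) J)}" for J
  \<comment> \<open>The row changed in step \<open>J\<close>: from the top if the current edge is
    entered at its even end, from the bottom otherwise, since the piece is then run in
    reverse.\<close>
  define row where "row J = (if ev (J div m) then J mod m else m - Suc (J mod m))" for J
  have JK: "J div m < K" "J mod m < m" if "J < m * K" for J
    using that m0 by (simp_all add: less_mult_imp_div_less mult.commute)
  have row: "row J < m" if "J < m * K" for J
    using JK[OF that] by (simp add: row_def)
  have \<tau>S: "\<tau> r (Suc J) = (if r = row J then Suc (\<tau> r J) else \<tau> r J)" if "r < m" for r J
  proof (cases "Suc (J mod m) = m")
    case True
    then have "Suc J div m = Suc (J div m)" "Suc J mod m = 0"
      by (simp_all add: div_Suc mod_Suc)
    then show ?thesis using that True by (auto simp: \<tau>_def row_def)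
  next
    case False
    then have "Suc J div m = J div m" "Suc J mod m = Suc (J mod m)"
      by (simp_all add: div_Suc mod_Suc)
    moreover have "Suc (J mod m) < m" using False mod_less_divisor[OF m0, of J] by linarith
    ultimately show ?thesis using that False by (auto simp: \<tau>_def row_def)
  qed
  have \<tau>_row: "\<tau> (row J) J = J div m" if "J < m * K" for J
    using JK[OF that] by (auto simp: \<tau>_def row_def)
  \<comment> \<open>Rows outside the array get a default index; by \<open>high\<close> their content
    is the same at all indices up to \<open>K\<close>.\<close>
  have \<tau>_high: "\<tau> r J = J div m" if "\<not> r < m" for r J
    using that by (simp add: \<tau>_def)
  have high: "b \<in> x j \<longleftrightarrow> b \<in> x 0" if "\<not> b < m * q" "j \<le> K" for b j
    using that(2)
  proof (induction j)
    case (Suc j)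
    then show ?case using xS[of j b] that(1) by (simp add: block_def)
  qed simp
  have \<tau>_le: "\<tau> r J \<le> K" if "J \<le> m * K" for r J
  proof (cases "J = m * K")
    case True
    then show ?thesis using m0 by (simp add: \<tau>_def)
  next
    case False
    then show ?thesis using JK[of J] that by (simp add: \<tau>_def)
  qed
  have div_lt: "b div q < m \<longleftrightarrow> b < m * q" if "q > 0" for b
    using that by (simp add: div_less_iff_less_mult)
  have step: "w (Suc J) = flip (row J * q + d (J div m)) (w J)" if J: "J < m * K" for J
  proof -
    let ?j = "J div m"
    have q: "q > 0" using d(1)[OF JK(1)[OF J]] by simp
    have b_iff: "b = row J * q + d ?j \<longleftrightarrow> b div q = row J \<and> b \<in> block q m (d ?j)" for b
    proof -
      have "b = row J * q + d ?j \<longleftrightarrow> b div q = row J \<and> b mod q = d ?j"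
        using d(1)[OF JK(1)[OF J]] by (metis div_mult_mod_eq div_mult_self3 div_less add.commute add_0 mod_less mod_mult_self3 not_less0)
      then show ?thesis using div_lt[OF q, of b] row[OF J] by (auto simp: block_def)
    qed
    have "b \<in> w (Suc J) \<longleftrightarrow> (b \<in> w J) \<noteq> (b = row J * q + d ?j)" for b
    proof (cases "b div q < m")
      case False
      then have nb: "\<not> b < m * q" using div_lt[OF q] by simp
      have "b \<in> w (Suc J) \<longleftrightarrow> b \<in> w J"
        using high[OF nb \<tau>_le[of J "b div q"]] high[OF nb \<tau>_le[of "Suc J" "b div q"]] J
        by (simp add: w_def)
      moreover have "b div q \<noteq> row J" using False row[OF J] by auto
      ultimately show ?thesis unfolding b_iff by simp
    next
      case True
      show ?thesis
      proof (cases "b div q = row J")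
        case r: True
        then show ?thesis
          using \<tau>S[OF True, of J] \<tau>_row[OF J] xS[OF JK(1)[OF J], of b] unfolding b_iff by (simp add: w_def)
      next
        case False
        then show ?thesis using \<tau>S[OF True, of J] unfolding b_iff by (simp add: w_def)
      qed
    qed
    then show ?thesis by (simp add: set_eq_iff)
  qed
  have start: "w J = shift q (J mod m) (d (J div m)) (x (J div m)) \<and> row J = J mod m"
    if J: "J < m * K" and e: "ev (J div m)" for J
  proof -
    let ?j = "J div m"
    have q: "q > 0" using d(1)[OF JK(1)[OF J]] by simp
    have "b \<in> w J \<longleftrightarrow> b \<in> shift q (J mod m) (d ?j) (x ?j)" for b
    proof (cases "b div q < J mod m")
      case True
      then have "b div q < m" using JK(2)[OF J] by simp
      then show ?thesis
        using True e xS[OF JK(1)[OF J], of b] div_lt[OF q, of b]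
        by (simp add: w_def \<tau>_def shift_def block_def)
    next
      case False
      then show ?thesis using e by (simp add: w_def \<tau>_def shift_def)
    qed
    then show ?thesis using e by (simp add: set_eq_iff row_def)
  qed
  \<comment> \<open>When the even end comes last, the edge is read from its later vertex
    \<open>w (Suc J)\<close>, as a shift of \<open>x (Suc (J div m))\<close>.\<close>
  have finish: "w (Suc J) = shift q (m - Suc (J mod m)) (d (J div m)) (x (Suc (J div m))) \<and>
      row J = m - Suc (J mod m)"
    if J: "J < m * K" and e: "\<not> ev (J div m)" for J
  proof -
    let ?j = "J div m" and ?r = "m - Suc (J mod m)"
    have q: "q > 0" using d(1)[OF JK(1)[OF J]] by simp
    have r: "row J = ?r" using e by (simp add: row_def)
    have "b \<in> w (Suc J) \<longleftrightarrow> b \<in> shift q ?r (d ?j) (x (Suc ?j))" for b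
    proof (cases "b div q < m")
      case True
      then have "b \<in> block q m (d ?j) \<longleftrightarrow> b mod q = d ?j" using div_lt[OF q, of b] by (auto simp: block_def)
      moreover have "\<tau> (b div q) (Suc J) = (if b div q < ?r then ?j else Suc ?j)"
      proof -
        have "\<tau> (b div q) J = ?j + (if m \<le> b div q + J mod m then 1 else 0)"
          using e True by (simp add: \<tau>_def)
        then show ?thesis
          using \<tau>S[OF True, of J] JK(2)[OF J] unfolding r
          by (cases "b div q" ?r rule: linorder_cases) auto
      qed
      ultimately show ?thesis
        using xS[OF JK(1)[OF J], of b] by (auto simp: w_def shift_def)
    next
      case False
      then have nb: "\<not> b < m * q" using div_lt[OF q] by simp
      have "b \<in> w (Suc J) \<longleftrightarrow> b \<in> x (Suc ?j)"
        using high[OF nb \<tau>_le[of "Suc J" "b div q"]] high[OF nb, of "Suc ?j"] J JK(1)[OF J]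
        by (simp add: w_def)
      then show ?thesis using False by (auto simp: shift_def)
    qed
    then show ?thesis using r by (simp add: set_eq_iff)
  qed
  have sub: "{w J, w (Suc J)} = sub_edge q m (if ev (J div m) then y (J div m) else y (Suc (J div m)))
      (d (J div m)) (row J)" if J: "J < m * K" for J
  proof (cases "ev (J div m)")
    case True
    then show ?thesis using start[OF J True] step[OF J] by (simp add: sub_edge_def x_def)
  next
    case False
    then have "w J = flip (row J * q + d (J div m)) (w (Suc J))" using step[OF J] by simp
    then show ?thesis using finish[OF J False] False by (simp add: sub_edge_def x_def insert_commute)
  qed
  have mono: "\<tau> r J \<le> \<tau> r J'" if "J \<le> J'" "r < m" for r J J'
    using that(1) by (induction J' rule: dec_induct) (use \<tau>S[OF that(2)] le_SucI in auto)
  have y_high: "b \<in> y k \<longleftrightarrow> b \<in> y 0" if "\<not> b < q" "k \<le> K" for b k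
    using that(2)
  proof (induction k)
    case (Suc k)
    then have "b \<noteq> d k" using d(1)[of k] that(1) by auto
    then show ?case using Suc d(2)[of k] by simp
  qed simp
  have y_neq: "\<exists>l<q. (l \<in> y i) \<noteq> (l \<in> y j)" if "i < j" "j \<le> K" for i j
  proof -
    have "y i \<noteq> y j" using dist len that by (simp add: y_def nth_eq_iff_index_eq)
    then obtain b where b: "(b \<in> y i) \<noteq> (b \<in> y j)" by blast
    then have "b < q" using y_high[of b i] y_high[of b j] that by fastforce
    then show ?thesis using b by blast
  qed
  \<comment> \<open>Two vertices of \<open>p\<close> differ in a direction below \<open>q\<close>,
    and \<open>spread\<close> copies this difference into every row of the array.\<close>
  have x_neq: "\<exists>b. b div q = r \<and> (b \<in> x i) \<noteq> (b \<in> x j)" if "i < j" "j \<le> K" "r < m" for i j r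
  proof -
    from y_neq[OF that(1,2)] obtain l where l: "l < q" "(l \<in> y i) \<noteq> (l \<in> y j)" by blast
    let ?b = "r * q + l"
    have b: "?b div q = r" "?b mod q = l" using l by simp_all
    have "?b \<in> block q m l" using block_eq[OF l(1)] that(3) by auto
    then have "?b < m * q" by (simp add: block_def)
    then have "(?b \<in> x i) \<noteq> (?b \<in> x j)"
    proof (cases "r = 0")
      case True
      then show ?thesis using l by (simp add: x_def spread_def)
    next
      case False
      then have "\<not> ?b < q" by (cases r) auto
      then have "?b \<in> y i \<longleftrightarrow> ?b \<in> y j" using y_high[of ?b i] y_high[of ?b j] that by simp
      then show ?thesis using l \<open>?b < m * q\<close> \<open>\<not> ?b < q\<close> b(2) by (simp add: x_def spread_def)
    qed
    then show ?thesis using b by blast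
  qed
  \<comment> \<open>After step \<open>J\<close> the row it changes shows a later vertex of
    \<open>p\<close> and, by monotonicity, never returns to the old index; by \<open>x_neq\<close>
    this one row tells the two times apart.\<close>
  have neq: "w J \<noteq> w J'" if "J < J'" "J' \<le> m * K" for J J'
  proof -
    have J: "J < m * K" using that by simp
    have "\<tau> (row J) J < \<tau> (row J) (Suc J)" using \<tau>S[OF row[OF J], of J] by simp
    also have "\<dots> \<le> \<tau> (row J) J'" using mono row[OF J] that by simp
    finally have "\<tau> (row J) J < \<tau> (row J) J'" .
    from x_neq[OF this \<tau>_le[OF that(2)] row[OF J]]
    obtain b where "b div q = row J" "(b \<in> x (\<tau> (row J) J)) \<noteq> (b \<in> x (\<tau> (row J) J'))" by blast
    then have "(b \<in> w J) \<noteq> (b \<in> w J')" by (simp add: w_def)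
    then show ?thesis by blast
  qed
  define p' where "p' = map w [0..<Suc (m * K)]"
  have len': "length p' = m * K + 1" by (simp add: p'_def)
  have nth': "p' ! J = w J" if "J \<le> m * K" for J
    using that unfolding p'_def by (subst nth_map) (auto simp del: upt_Suc)
  have "distinct p'"
  proof -
    have "inj_on w {0..<Suc (m * K)}"
    proof (rule inj_onI)
      fix i j assume "i \<in> {0..<Suc (m * K)}" "j \<in> {0..<Suc (m * K)}" "w i = w j"
      then show "i = j" using neq[of i j] neq[of j i] by (cases i j rule: linorder_cases) auto
    qed
    then show ?thesis by (simp add: p'_def distinct_map del: upt_Suc)
  qed
  moreover have "{p' ! J, p' ! (J + 1)} \<in> cube_edges {..<m * q}" if J: "J < m * K" for J
  proof -
    have "row J * q + d (J div m) \<in> block q m (d (J div m))"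
      using block_eq[OF d(1)[OF JK(1)[OF J]]] row[OF J] by auto
    then show ?thesis using J step[OF J] by (simp add: nth' block_def)
  qed
  ultimately have "is_path_of_length UNIV (cube_edges {..<m * q}) (m * K) p'"
    using len' by (simp add: is_path_of_length_def)
  moreover have "path_edges p' = {sub_edge q m z l r | z l r. l < q \<and> r < m \<and>
      even_at q m l (spread q m z) \<and> {z, flip l z} \<in> path_edges p}" (is "_ = ?R")
  proof
    show "path_edges p' \<subseteq> ?R"
    proof
      fix e assume "e \<in> path_edges p'"
      then obtain J where J: "J < m * K" "e = {w J, w (Suc J)}"
        by (auto simp: path_edges_def len' nth')
      let ?j = "J div m" and ?z = "if ev (J div m) then y (J div m) else y (Suc (J div m))"
      have j: "?j < K" using JK(1)[OF J(1)] .
      have "{?z, flip (d ?j) ?z} = {p ! ?j, p ! (?j + 1)}"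
        using d(2)[OF j] by (auto simp: y_def)
      then have "{?z, flip (d ?j) ?z} \<in> path_edges p" using j len unfolding path_edges_def by auto
      moreover have "even_at q m (d ?j) (spread q m ?z)"
        using evS[OF j] by (auto simp: ev_def x_def)
      ultimately show "e \<in> ?R" using J sub[OF J(1)] row[OF J(1)] d(1)[OF j] by blast
    qed
    show "?R \<subseteq> path_edges p'"
    proof
      fix e assume "e \<in> ?R"
      then obtain z l r where lr: "l < q" "r < m" and z: "even_at q m l (spread q m z)"
        "{z, flip l z} \<in> path_edges p" and e: "e = sub_edge q m z l r" by blast
      obtain j where j: "j < K" "{z, flip l z} = {y j, y (Suc j)}"
        using z(2) len by (auto simp: path_edges_def y_def)
      then have "{z, flip l z} = {y j, flip (d j) (y j)}" using d(2) by simp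
      then have l: "l = d j" and zc: "z = y j \<or> z = y (Suc j)"
        unfolding flip_edge_eq_iff using d(2)[OF j(1)] by auto
      have zj: "z = (if ev j then y j else y (Suc j))"
        using zc z(1) evS[OF j(1)] unfolding l by (auto simp: ev_def x_def)
      \<comment> \<open>Piece \<open>r\<close> is reached after \<open>r\<close> steps from the even
        end of edge \<open>j\<close>, that is after \<open>m - Suc r\<close> steps if the edge is
        run towards its even end.\<close>
      define J where "J = m * j + (if ev j then r else m - Suc r)"
      have pos: "(if ev j then r else m - Suc r) < m" using lr by simp
      then have Jj: "J div m = j" "J mod m = (if ev j then r else m - Suc r)" unfolding J_def by simp_all
      have "J < m * Suc j" using pos unfolding J_def by simp
      also have "\<dots> \<le> m * K" using j by (intro mult_le_mono2) simp
      finally have JK': "J < m * K" .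
      have "row J = r" using Jj lr by (simp add: row_def)
      then have "e = {w J, w (Suc J)}" using sub[OF JK'] e Jj l zj by simp
      then have "e = {p' ! J, p' ! (J + 1)} \<and> J + 1 < length p'" using JK' len' nth' by simp
      then show "e \<in> path_edges p'" unfolding path_edges_def by blast
    qed
  qed
  ultimately show ?thesis by blast
qed

text \<open>Every edge of the large cube is a piece of exactly one edge of the small cube, so it
  lies only on the path that replaces the path through that edge.\<close>

lemma decomposable_subdivide:
  assumes m: "odd m" and dec: "decomposable (cube_edges {..<q}) K"
  shows "decomposable (cube_edges {..<m * q}) (m * K)"
proof -
  define sub where "sub p = {sub_edge q m y l r | y l r. l < q \<and> r < m \<and>
      even_at q m l (spread q m y) \<and> {y, flip l y} \<in> path_edges p}" for p
  obtain P where P: "is_path_decomposition UNIV (cube_edges {..<q}) K P"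
    using dec unfolding decomposable_def by blast
  have "\<forall>p\<in>P. \<exists>p'. is_path_of_length UNIV (cube_edges {..<m * q}) (m * K) p' \<and> path_edges p' = sub p"
    using subdivided_path[OF m] P unfolding is_path_decomposition_def sub_def by simp
  then obtain h where h: "\<And>p. p \<in> P \<Longrightarrow> is_path_of_length UNIV (cube_edges {..<m * q}) (m * K) (h p)"
    "\<And>p. p \<in> P \<Longrightarrow> path_edges (h p) = sub p" by metis
  have "\<exists>!p'. p' \<in> h ` P \<and> e \<in> path_edges p'" if "e \<in> cube_edges {..<m * q}" for e
  proof -
    from that obtain z b where "b < m * q" "e = {z, flip b z}" unfolding cube_edges_def by auto
    then obtain y l r where ylr: "l < q" "r < m" "even_at q m l (spread q m y)" and e: "e = sub_edge q m y l r"
      using sub_edge_surj by metis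
    have "{y, flip l y} \<in> cube_edges {..<q}" using ylr by simp
    then obtain p where p: "p \<in> P" "{y, flip l y} \<in> path_edges p"
      and uniq: "\<And>p'. p' \<in> P \<Longrightarrow> {y, flip l y} \<in> path_edges p' \<Longrightarrow> p' = p"
      using P unfolding is_path_decomposition_def by metis
    show ?thesis
    proof (rule ex1I[of _ "h p"])
      show "h p \<in> h ` P \<and> e \<in> path_edges (h p)" using p ylr e h(2)[OF p(1)] unfolding sub_def by blast
      fix p' assume "p' \<in> h ` P \<and> e \<in> path_edges p'"
      then obtain p2 where p2: "p2 \<in> P" "p' = h p2" "e \<in> sub p2" using h(2) by blast
      then obtain y2 l2 r2 where y2: "e = sub_edge q m y2 l2 r2" "l2 < q" "r2 < m"
        "even_at q m l2 (spread q m y2)" "{y2, flip l2 y2} \<in> path_edges p2" unfolding sub_def by blast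
      have "y = y2 \<and> l = l2"
        using sub_edge_inj[of q m y l r y2 l2 r2] e y2 ylr by simp
      then have "p2 = p" using uniq p2(1) y2(5) by simp
      then show "p' = h p" using p2 by simp
    qed
  qed
  then show ?thesis using h(1) unfolding decomposable_def is_path_decomposition_def
    by (intro exI[of _ "h ` P"]) auto
qed

section \<open>The hypercube of 0-1 functions\<close>

lemma decomposable_cube_1: "decomposable (cube_edges I) 1"
proof -
  \<comment> \<open>Every edge is started at its end not containing \<open>d\<close>, so that it is
    listed in one direction only.\<close>
  let ?S = "{(x, d). d \<in> I \<and> d \<notin> x}"
  define w where "w = (\<lambda>(x, d) j. if j = (0 :: nat) then x else flip d x)"
  have "decomposable ((\<lambda>(s, j). {w s j, w s (Suc j)}) ` (?S \<times> {..<1})) 1"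
  proof (rule decomposable_walks)
    fix s assume "s \<in> ?S"
    then show "inj_on (w s) {..1}"
      by (cases s) (auto simp: inj_on_def w_def le_Suc_eq)
  next
    show "inj_on (\<lambda>(s, j). {w s j, w s (Suc j)}) (?S \<times> {..<1})"
    proof (rule inj_onI)
      fix a b
      assume ab: "a \<in> ?S \<times> {..<1}" "b \<in> ?S \<times> {..<1}"
        and eq: "(\<lambda>(s, j). {w s j, w s (Suc j)}) a = (\<lambda>(s, j). {w s j, w s (Suc j)}) b"
      obtain x d y e where a: "a = ((x, d), 0)" "d \<notin> x" and b: "b = ((y, e), 0)" "e \<notin> y"
        using ab by auto
      have "{x, flip d x} = {y, flip e y}" using eq by (simp add: a b w_def)
      then have de: "d = e" and "x = y \<or> x = flip e y" unfolding flip_edge_eq_iff by auto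
      moreover have "x \<noteq> flip e y" using a(2) b(2) de by auto
      ultimately show "a = b" using a b by simp
    qed
  qed
  moreover have "(\<lambda>(s, j). {w s j, w s (Suc j)}) ` (?S \<times> {..<1}) = cube_edges I" (is "?L = _")
  proof
    show "?L \<subseteq> cube_edges I" by (auto simp: w_def)
    show "cube_edges I \<subseteq> ?L"
    proof
      fix e assume "e \<in> cube_edges I"
      then obtain x d where e: "e = {x, flip d x}" "d \<in> I" unfolding cube_edges_def by auto
      define y where "y = (if d \<in> x then flip d x else x)"
      have "d \<notin> y" "e = {y, flip d y}" using e by (auto simp: y_def)
      then show "e \<in> ?L" using e by (intro image_eqI[of _ _ "((y, d), 0)"]) (auto simp: w_def)
    qed
  qed
  ultimately show ?thesis by simp
qed

section \<open>Sets of coordinates as 0-1 functions\<close>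

definition vertex :: "nat \<Rightarrow> nat set \<Rightarrow> nat \<Rightarrow> int" where
  "vertex n x = restrict (\<lambda>i. of_bool (i \<in> x)) {..<n}"

lemma vertex_inj: "inj_on (vertex n) (Pow {..<n})"
proof (rule inj_onI)
  fix x y assume xy: "x \<in> Pow {..<n}" "y \<in> Pow {..<n}" "vertex n x = vertex n y"
  have "i \<in> x \<longleftrightarrow> i \<in> y" if "i < n" for i
    using fun_cong[OF xy(3), of i] that by (simp add: vertex_def of_bool_eq_iff)
  then show "x = y" using xy by blast
qed

lemma vertex_image: "vertex n ` Pow {..<n} = hypercube_verts n"
proof
  show "vertex n ` Pow {..<n} \<subseteq> hypercube_verts n"
    by (auto simp: vertex_def hypercube_verts_def PiE_iff of_bool_def split: if_splits)
  show "hypercube_verts n \<subseteq> vertex n ` Pow {..<n}"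
  proof
    fix f assume "f \<in> hypercube_verts n"
    then have f: "f \<in> {..<n} \<rightarrow>\<^sub>E {0, 1}" by (simp add: hypercube_verts_def)
    have "f = vertex n {i. i < n \<and> f i = 1}"
    proof
      fix i show "f i = vertex n {i. i < n \<and> f i = 1} i"
        using PiE_mem[OF f, of i] PiE_arb[OF f, of i] by (auto simp: vertex_def)
    qed
    then show "f \<in> vertex n ` Pow {..<n}" by blast
  qed
qed

lemma l1_dist_vertex:
  assumes "x \<subseteq> {..<n}" "y \<subseteq> {..<n}"
  shows "l1_dist n (vertex n x) (vertex n y) = 1 \<longleftrightarrow> (\<exists>d<n. y = flip d x)"
proof -
  let ?D = "{i. (i \<in> x) \<noteq> (i \<in> y)}"
  have D: "?D \<subseteq> {..<n}" using assms by auto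
  have "l1_dist n (vertex n x) (vertex n y) = (\<Sum>i<n. if i \<in> ?D then 1 else 0)"
    unfolding l1_dist_def by (rule sum.cong) (auto simp: vertex_def)
  also have "\<dots> = int (card ({..<n} \<inter> ?D))" by (subst sum.If_cases) auto
  also have "{..<n} \<inter> ?D = ?D" using D by blast
  finally have "l1_dist n (vertex n x) (vertex n y) = 1 \<longleftrightarrow> (\<exists>d. ?D = {d})"
    by (simp add: card_1_singleton_iff)
  also have "\<dots> \<longleftrightarrow> (\<exists>d. y = flip d x)"
  proof -
    have "?D = {d} \<longleftrightarrow> y = flip d x" for d by (auto simp: set_eq_iff)
    then show ?thesis by simp
  qed
  also have "\<dots> \<longleftrightarrow> (\<exists>d<n. y = flip d x)"
  proof -
    have "d < n" if "y = flip d x" for d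
    proof -
      have "d \<in> x \<or> d \<in> y" using that by simp
      then show ?thesis using assms by blast
    qed
    then show ?thesis by blast
  qed
  finally show ?thesis .
qed

lemma hypercube_edges_vertex:
  "hypercube_edges n = (`) (vertex n) ` {e \<in> cube_edges {..<n}. e \<subseteq> Pow {..<n}}"
proof
  show "hypercube_edges n \<subseteq> (`) (vertex n) ` {e \<in> cube_edges {..<n}. e \<subseteq> Pow {..<n}}"
  proof
    fix e assume "e \<in> hypercube_edges n"
    then obtain f g where e: "e = {f, g}" "f \<in> hypercube_verts n" "g \<in> hypercube_verts n" "l1_dist n f g = 1"
      unfolding hypercube_edges_def by blast
    then obtain x y where xy: "f = vertex n x" "g = vertex n y" "x \<subseteq> {..<n}" "y \<subseteq> {..<n}"
      unfolding vertex_image[symmetric] by blast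
    then obtain d where d: "d < n" "y = flip d x" using e(4) l1_dist_vertex by blast
    then have "{x, y} \<in> {e \<in> cube_edges {..<n}. e \<subseteq> Pow {..<n}}" using xy by simp
    moreover have "e = vertex n ` {x, y}" using e xy by simp
    ultimately show "e \<in> (`) (vertex n) ` {e \<in> cube_edges {..<n}. e \<subseteq> Pow {..<n}}" by blast
  qed
  show "(`) (vertex n) ` {e \<in> cube_edges {..<n}. e \<subseteq> Pow {..<n}} \<subseteq> hypercube_edges n"
  proof
    fix e assume "e \<in> (`) (vertex n) ` {e \<in> cube_edges {..<n}. e \<subseteq> Pow {..<n}}"
    then obtain e' where e': "e = vertex n ` e'" "e' \<in> cube_edges {..<n}" "e' \<subseteq> Pow {..<n}" by blast
    then obtain x d where x: "e' = {x, flip d x}" "d < n" unfolding cube_edges_def by auto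
    have sub: "x \<subseteq> {..<n}" "flip d x \<subseteq> {..<n}" using e' x by auto
    have "l1_dist n (vertex n x) (vertex n (flip d x)) = 1"
      using l1_dist_vertex[OF sub] x by blast
    moreover have "e = {vertex n x, vertex n (flip d x)}" using e' x by simp
    moreover have "vertex n x \<in> hypercube_verts n" "vertex n (flip d x) \<in> hypercube_verts n"
      using sub vertex_image by blast+
    ultimately show "e \<in> hypercube_edges n" unfolding hypercube_edges_def by blast
  qed
qed

text \<open>Flips below \<open>n\<close> preserve \<open>Pow {..<n}\<close>, so the decomposition
  restricts to this copy of the cube and \<open>vertex\<close> carries it over to functions.\<close>

lemma hypercube_decomposition:
  assumes "decomposable (cube_edges {..<n}) k"
  shows "\<exists>P. is_path_decomposition (hypercube_verts n) (hypercube_edges n) k P"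
proof -
  have "b \<in> Pow {..<n}" if e: "{a, b} \<in> cube_edges {..<n}" and a: "a \<in> Pow {..<n}" for a b
  proof -
    from cube_edgeD[OF e] obtain d where "d < n" "b = flip d a" by auto
    then show ?thesis using a by (auto simp: flip_def)
  qed
  then obtain P where P: "is_path_decomposition (Pow {..<n}) {e \<in> cube_edges {..<n}. e \<subseteq> Pow {..<n}} k P"
    using decomposable_restrict[OF assms, of "Pow {..<n}"] by blast
  have "\<Union>{e \<in> cube_edges {..<n}. e \<subseteq> Pow {..<n}} \<subseteq> Pow {..<n}" by blast
  from is_path_decomposition_image[OF P vertex_inj this] show ?thesis
    unfolding vertex_image hypercube_edges_vertex by blast
qed

theorem theorem1p2:
  fixes n k :: nat
  assumes "odd n" and "n > 0" and "k > 0" and "k dvd n * 2 ^ (n - 1)" and "k \<le> n"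
  shows "\<exists>P. is_path_decomposition (hypercube_verts n) (hypercube_edges n) k P"
proof -
  obtain s m where km: "k = m * 2 ^ s" "odd m"
    using \<open>k > 0\<close>
  proof (induction k arbitrary: thesis rule: less_induct)
    case (less k)
    show ?case
    proof (cases "even k")
      case True
      then obtain k' where k': "k = 2 * k'" by (elim evenE)
      obtain m s where "k' = m * 2 ^ s" "odd m" using less.IH[of k'] less.prems k' by auto
      then show ?thesis using less.prems(1)[of m "Suc s"] k' by simp
    next
      case False
      then show ?thesis using less.prems(1)[of k 0] by simp
    qed
  qed
  have "m dvd n * 2 ^ (n - 1)" using assms(4) km by (metis dvd_mult_left)
  moreover have "coprime m (2 ^ (n - 1))" using \<open>odd m\<close> by simp
  ultimately have "m dvd n" by (simp add: coprime_dvd_mult_left_iff)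
  then obtain q where n: "n = m * q" by (elim dvdE)
  have "m > 0" using odd_pos[OF \<open>odd m\<close>] .
  \<comment> \<open>\<open>q\<close> divides the odd \<open>n\<close>, and cancelling
    \<open>m\<close> in \<open>m * 2 ^ s \<le> m * q\<close> gives the bound.\<close>
  then have q: "odd q" "2 ^ s \<le> q" using assms(1,5) km n by simp_all
  have "decomposable (cube_edges {..<q}) (2 ^ s)"
  proof (cases "s = 0")
    case True
    then show ?thesis using decomposable_cube_1 by simp
  next
    case False
    then show ?thesis using decomposable_cube_power2 q by simp
  qed
  from decomposable_subdivide[OF \<open>odd m\<close> this] show ?thesis
    using hypercube_decomposition km n by simp
qed

end
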